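(* Let $(M,D,g)$ be a pseudo-Euclidean manifold and let $\nabla$ be the hybrid connection defined by a hybrid potential $\psi$. Then for every $\alpha>0$, $\nabla$ is isochrone to the metric $$h=\frac{\alpha^2}{\psi^4}\,g.$$ Moreover, these are the only metrics isochrone to $\nabla$ in the same conformal class as $g$, i.e. the only ones of the form $\rho\, g$ where $\rho$ is a positive function on $M$.
   Context: All manifolds, connections and metrics are smooth; "metric" means pseudo-Riemannian metric. A metric $h$ and an affine connection are isochrone to each other if the geodesics $\gamma$ of the connection (with their affine parameterization) have constant speed with respect to the metric, i.e. $h(\dot\gamma,\dot\gamma)$ is constant along $\gamma$. The Hessian $H(f)$ of a function $f$ is the $(0,2)$-tensor with matrix $\left(\frac{\partial^2 f}{\partial x_i\partial x_j}\right)$ in affine charts (charts in which the flat affine connection $D$ is the canonical connection of $\mathbb{R}^d$). A Hessian manifold $(M,D,g)$: $M$ connected of dimension $d\ge2$, $D$ a flat (torsion-free, zero curvature) affine connection, $g$ a pseudo-Riemannian metric of arbitrary signature locally of the form $H(\psi)$. It is a pseudo-Euclidean manifold if moreover $g$ is constant in the affine charts of $D$. The hybrid connection defined by a hybrid potential $\psi$ is the affine connection $\nabla_u v = D_u v - \frac{d\psi(u)v+d\psi(v)u}{\psi}$ ($u$ a tangent vector, $v$ a local vector field), where $\psi:M\to\mathbb{R}\setminus\{0\}$ is a smooth function with $H(\psi)=g$; $\psi$ is uniquely determined by $\nabla$ and $g$. *)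

theory Defs
  imports "HOL-Analysis.Analysis"
begin

primrec Ck_on :: "nat \<Rightarrow> 'a::real_normed_vector set \<Rightarrow> ('a \<Rightarrow> 'b::real_normed_vector) \<Rightarrow> bool" where
  "Ck_on 0 S f \<longleftrightarrow> continuous_on S f"
| "Ck_on (Suc k) S f \<longleftrightarrow>
     (\<forall>x\<in>S. f differentiable (at x)) \<and> (\<forall>v. Ck_on k S (\<lambda>x. frechet_derivative f (at x) v))"

text \<open>Only meaningful for open \<open>S\<close>, since the derivatives are taken in full neighbourhoods.\<close>
definition smooth_on :: "'a::real_normed_vector set \<Rightarrow> ('a \<Rightarrow> 'b::real_normed_vector) \<Rightarrow> bool" where
  "smooth_on S f \<longleftrightarrow> (\<forall>k. Ck_on k S f)"

text \<open>The second derivative of \<open>f\<close> at \<open>x\<close> in the directions \<open>u\<close>, \<open>v\<close>; for \<open>u = axis i 1\<close> and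
  \<open>v = axis j 1\<close> it is the partial derivative \<open>\<partial>\<^sub>i \<partial>\<^sub>j f\<close>.\<close>
definition second_derivative ::
    "('a::real_normed_vector \<Rightarrow> 'b::real_normed_vector) \<Rightarrow> 'a \<Rightarrow> 'a \<Rightarrow> 'a \<Rightarrow> 'b" where
  "second_derivative f x u v = frechet_derivative (\<lambda>y. frechet_derivative f (at y) v) (at x) u"

text \<open>A chart is a domain together with a coordinate map, whose values outside the domain are
  irrelevant. A manifold is an abstract topology with a maximal smooth atlas; its dimension is
  \<open>CARD('n)\<close>.\<close>
type_synonym ('m, 'n) chart = "'m set \<times> ('m \<Rightarrow> real ^ 'n)"

abbreviation chart_dom :: "('m, 'n) chart \<Rightarrow> 'm set" where "chart_dom c \<equiv> fst c"
abbreviation coord :: "('m, 'n) chart \<Rightarrow> 'm \<Rightarrow> real ^ 'n" where "coord c \<equiv> snd c"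

definition inv_coord :: "('m, 'n) chart \<Rightarrow> real ^ 'n \<Rightarrow> 'm" where
  "inv_coord c = inv_into (chart_dom c) (coord c)"

definition is_chart :: "'m topology \<Rightarrow> ('m, 'n::finite) chart \<Rightarrow> bool" where
  "is_chart M c \<longleftrightarrow>
     openin M (chart_dom c) \<and> open (coord c ` chart_dom c) \<and>
     homeomorphic_map (subtopology M (chart_dom c)) (top_of_set (coord c ` chart_dom c)) (coord c)"

definition transition :: "('m, 'n) chart \<Rightarrow> ('m, 'n) chart \<Rightarrow> real ^ 'n \<Rightarrow> real ^ 'n" where
  "transition c c' = coord c' \<circ> inv_coord c"

definition compatible :: "('m, 'n::finite) chart \<Rightarrow> ('m, 'n) chart \<Rightarrow> bool" where
  "compatible c c' \<longleftrightarrow>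
     smooth_on (coord c ` (chart_dom c \<inter> chart_dom c')) (transition c c') \<and>
     smooth_on (coord c' ` (chart_dom c \<inter> chart_dom c')) (transition c' c)"

definition smooth_manifold :: "'m topology \<Rightarrow> ('m, 'n::finite) chart set \<Rightarrow> bool" where
  "smooth_manifold M A \<longleftrightarrow>
     Hausdorff_space M \<and> second_countable M \<and>
     (\<forall>c\<in>A. is_chart M c) \<and>
     (\<Union>c\<in>A. chart_dom c) = topspace M \<and>
     (\<forall>c\<in>A. \<forall>c'\<in>A. compatible c c') \<and>
     (\<forall>c. is_chart M c \<and> (\<forall>c'\<in>A. compatible c c') \<longrightarrow> c \<in> A)"

definition smooth_function :: "('m, 'n::finite) chart set \<Rightarrow> 'm set \<Rightarrow> ('m \<Rightarrow> real) \<Rightarrow> bool" where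
  "smooth_function A V f \<longleftrightarrow>
     (\<forall>c\<in>A. smooth_on (coord c ` (chart_dom c \<inter> V)) (f \<circ> inv_coord c))"

text \<open>The differential of \<open>f\<close> at \<open>p\<close>, on the tangent vector with components \<open>u\<close> in the chart \<open>c\<close>.\<close>
definition differential :: "('m, 'n::finite) chart \<Rightarrow> ('m \<Rightarrow> real) \<Rightarrow> 'm \<Rightarrow> real ^ 'n \<Rightarrow> real" where
  "differential c f p u = frechet_derivative (f \<circ> inv_coord c) (at (coord c p)) u"

text \<open>The components in \<open>c'\<close> of the tangent vector at \<open>p\<close> with components \<open>u\<close> in \<open>c\<close>.\<close>
definition change_vec ::
    "('m, 'n::finite) chart \<Rightarrow> ('m, 'n) chart \<Rightarrow> 'm \<Rightarrow> real ^ 'n \<Rightarrow> real ^ 'n" where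
  "change_vec c c' p u = frechet_derivative (transition c c') (at (coord c p)) u"

text \<open>A \<open>(0,2)\<close>-tensor \<open>g\<close> is given by its bilinear form \<open>g c p\<close> in every chart \<open>c\<close> at every point
  \<open>p\<close> of the chart domain. Metrics are of arbitrary signature.\<close>
type_synonym ('m, 'n) tensor02 = "('m, 'n) chart \<Rightarrow> 'm \<Rightarrow> real ^ 'n \<Rightarrow> real ^ 'n \<Rightarrow> real"

definition pseudo_metric :: "('m, 'n::finite) chart set \<Rightarrow> ('m, 'n) tensor02 \<Rightarrow> bool" where
  "pseudo_metric A g \<longleftrightarrow>
     (\<forall>c\<in>A. \<forall>p\<in>chart_dom c.
        bilinear (g c p) \<and>
        (\<forall>u v. g c p u v = g c p v u) \<and>
        (\<forall>u. (\<forall>v. g c p u v = 0) \<longrightarrow> u = 0)) \<and>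
     (\<forall>c\<in>A. \<forall>u v. smooth_on (coord c ` chart_dom c) (\<lambda>x. g c (inv_coord c x) u v)) \<and>
     (\<forall>c\<in>A. \<forall>c'\<in>A. \<forall>p\<in>chart_dom c \<inter> chart_dom c'. \<forall>u v.
        g c p u v = g c' p (change_vec c c' p u) (change_vec c c' p v))"

text \<open>An affine connection is given by its Christoffel symbols: in a chart \<open>c\<close>, the covariant
  derivative at \<open>p\<close> of the local vector field \<open>v\<close> along \<open>u\<close> is \<open>dv(u) + D c p u (v(p))\<close>, that is,
  \<open>D c p (axis i 1) (axis j 1) $ k\<close> is \<open>\<Gamma>\<^sup>k\<^sub>i\<^sub>j\<close>.\<close>
type_synonym ('m, 'n) connection = "('m, 'n) chart \<Rightarrow> 'm \<Rightarrow> real ^ 'n \<Rightarrow> real ^ 'n \<Rightarrow> real ^ 'n"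

definition affine_connection :: "('m, 'n::finite) chart set \<Rightarrow> ('m, 'n) connection \<Rightarrow> bool" where
  "affine_connection A D \<longleftrightarrow>
     (\<forall>c\<in>A. \<forall>p\<in>chart_dom c. bilinear (D c p)) \<and>
     (\<forall>c\<in>A. \<forall>u v. smooth_on (coord c ` chart_dom c) (\<lambda>x. D c (inv_coord c x) u v)) \<and>
     (\<forall>c\<in>A. \<forall>c'\<in>A. \<forall>p\<in>chart_dom c \<inter> chart_dom c'. \<forall>u v.
        change_vec c c' p (D c p u v) =
          second_derivative (transition c c') (coord c p) u v +
          D c' p (change_vec c c' p u) (change_vec c c' p v))"

definition torsion_free :: "('m, 'n::finite) chart set \<Rightarrow> ('m, 'n) connection \<Rightarrow> bool" where
  "torsion_free A D \<longleftrightarrow> (\<forall>c\<in>A. \<forall>p\<in>chart_dom c. \<forall>u v. D c p u v = D c p v u)"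

text \<open>The curvature \<open>R(u,v)w\<close>, evaluated on the coordinate fields with constant components
  \<open>u\<close>, \<open>v\<close>, \<open>w\<close> (so that \<open>[u,v] = 0\<close>).\<close>
definition curvature ::
    "('m, 'n::finite) connection \<Rightarrow> ('m, 'n) chart \<Rightarrow> 'm \<Rightarrow> real ^ 'n \<Rightarrow> real ^ 'n \<Rightarrow> real ^ 'n \<Rightarrow> real ^ 'n"
  where
  "curvature D c p u v w =
     frechet_derivative (\<lambda>x. D c (inv_coord c x) v w) (at (coord c p)) u
     - frechet_derivative (\<lambda>x. D c (inv_coord c x) u w) (at (coord c p)) v
     + D c p u (D c p v w) - D c p v (D c p u w)"

definition flat_connection :: "('m, 'n::finite) chart set \<Rightarrow> ('m, 'n) connection \<Rightarrow> bool" where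
  "flat_connection A D \<longleftrightarrow>
     affine_connection A D \<and> torsion_free A D \<and>
     (\<forall>c\<in>A. \<forall>p\<in>chart_dom c. \<forall>u v w. curvature D c p u v w = 0)"

text \<open>The charts in which \<open>D\<close> is the canonical connection.\<close>
definition affine_charts ::
    "('m, 'n::finite) chart set \<Rightarrow> ('m, 'n) connection \<Rightarrow> ('m, 'n) chart set" where
  "affine_charts A D = {c \<in> A. \<forall>p\<in>chart_dom c. \<forall>u v. D c p u v = 0}"

text \<open>\<open>g = H(f)\<close> on \<open>V\<close>. Both sides being tensors, it is enough to compare them in affine charts,
  where the matrix of \<open>H(f)\<close> consists of the second partial derivatives.\<close>
definition is_Hessian_of ::
    "('m, 'n::finite) chart set \<Rightarrow> ('m, 'n) connection \<Rightarrow> 'm set \<Rightarrow> ('m, 'n) tensor02 \<Rightarrow>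
     ('m \<Rightarrow> real) \<Rightarrow> bool" where
  "is_Hessian_of A D V g f \<longleftrightarrow>
     (\<forall>c\<in>affine_charts A D. \<forall>p\<in>chart_dom c \<inter> V. \<forall>i j.
        g c p (axis i 1) (axis j 1) =
        second_derivative (f \<circ> inv_coord c) (coord c p) (axis i 1) (axis j 1))"

definition Hessian_manifold ::
    "'m topology \<Rightarrow> ('m, 'n::finite) chart set \<Rightarrow> ('m, 'n) connection \<Rightarrow> ('m, 'n) tensor02 \<Rightarrow> bool"
  where
  "Hessian_manifold M A D g \<longleftrightarrow>
     smooth_manifold M A \<and> connected_space M \<and> CARD('n) \<ge> 2 \<and>
     flat_connection A D \<and> pseudo_metric A g \<and>
     (\<forall>p\<in>topspace M. \<exists>V f. openin M V \<and> p \<in> V \<and> smooth_function A V f \<and> is_Hessian_of A D V g f)"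

text \<open>On an affine chart with disconnected domain, \<open>g\<close> need only be locally constant.\<close>
definition pseudo_Euclidean_manifold ::
    "'m topology \<Rightarrow> ('m, 'n::finite) chart set \<Rightarrow> ('m, 'n) connection \<Rightarrow> ('m, 'n) tensor02 \<Rightarrow> bool"
  where
  "pseudo_Euclidean_manifold M A D g \<longleftrightarrow>
     Hessian_manifold M A D g \<and>
     (\<forall>c\<in>affine_charts A D. connectedin M (chart_dom c) \<longrightarrow>
        (\<forall>p\<in>chart_dom c. \<forall>q\<in>chart_dom c. g c p = g c q))"

definition hybrid_potential ::
    "'m topology \<Rightarrow> ('m, 'n::finite) chart set \<Rightarrow> ('m, 'n) connection \<Rightarrow> ('m, 'n) tensor02 \<Rightarrow>
     ('m \<Rightarrow> real) \<Rightarrow> bool" where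
  "hybrid_potential M A D g \<psi> \<longleftrightarrow>
     smooth_function A (topspace M) \<psi> \<and> (\<forall>p\<in>topspace M. \<psi> p \<noteq> 0) \<and>
     is_Hessian_of A D (topspace M) g \<psi>"

definition hybrid_connection ::
    "('m, 'n::finite) connection \<Rightarrow> ('m \<Rightarrow> real) \<Rightarrow> ('m, 'n) connection" where
  "hybrid_connection D \<psi> = (\<lambda>c p u v.
     D c p u v - (1 / \<psi> p) *\<^sub>R (differential c \<psi> p u *\<^sub>R v + differential c \<psi> p v *\<^sub>R u))"

definition smooth_curve ::
    "'m topology \<Rightarrow> ('m, 'n::finite) chart set \<Rightarrow> real set \<Rightarrow> (real \<Rightarrow> 'm) \<Rightarrow> bool" where
  "smooth_curve M A I \<gamma> \<longleftrightarrow>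
     continuous_map (top_of_set I) M \<gamma> \<and>
     (\<forall>c\<in>A. smooth_on {t \<in> I. \<gamma> t \<in> chart_dom c} (coord c \<circ> \<gamma>))"

definition velocity :: "('m, 'n::finite) chart \<Rightarrow> (real \<Rightarrow> 'm) \<Rightarrow> real \<Rightarrow> real ^ 'n" where
  "velocity c \<gamma> t = vector_derivative (coord c \<circ> \<gamma>) (at t)"

text \<open>Affinely parameterized geodesics, on open intervals.\<close>
definition geodesic ::
    "'m topology \<Rightarrow> ('m, 'n::finite) chart set \<Rightarrow> ('m, 'n) connection \<Rightarrow> real set \<Rightarrow> (real \<Rightarrow> 'm) \<Rightarrow> bool"
  where
  "geodesic M A D I \<gamma> \<longleftrightarrow>
     open I \<and> is_interval I \<and> smooth_curve M A I \<gamma> \<and>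
     (\<forall>c\<in>A. \<forall>t\<in>I. \<gamma> t \<in> chart_dom c \<longrightarrow>
        vector_derivative (velocity c \<gamma>) (at t) +
        D c (\<gamma> t) (velocity c \<gamma> t) (velocity c \<gamma> t) = 0)"

definition isochrone ::
    "'m topology \<Rightarrow> ('m, 'n::finite) chart set \<Rightarrow> ('m, 'n) connection \<Rightarrow> ('m, 'n) tensor02 \<Rightarrow> bool"
  where
  "isochrone M A D h \<longleftrightarrow>
     affine_connection A D \<and> pseudo_metric A h \<and>
     (\<forall>I \<gamma>. geodesic M A D I \<gamma> \<longrightarrow>
        (\<exists>s. \<forall>t\<in>I. \<forall>c\<in>A. \<gamma> t \<in> chart_dom c \<longrightarrow>
           h c (\<gamma> t) (velocity c \<gamma> t) (velocity c \<gamma> t) = s))"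

definition scale_tensor :: "('m \<Rightarrow> real) \<Rightarrow> ('m, 'n) tensor02 \<Rightarrow> ('m, 'n) tensor02" where
  "scale_tensor \<rho> g = (\<lambda>c p u v. \<rho> p * g c p u v)"

end

theory Submission
  imports Defs
begin

text \<open>Parallel 1-forms and vector fields of a torsion-free flat connection exist locally, because the
  defect of the Picard iterates for parallel transport along rays contracts; the parallel 1-forms
  are closed, and their primitives form affine charts around every point. In an affine chart the
  geodesics of the hybrid connection satisfy \<open>x'' = 2 (d\<psi>(x')/\<psi>) x'\<close>, so \<open>g(x',x')/\<psi>\<^sup>4\<close> is
  constant along them. Conversely, these geodesics are the straight segments with velocity \<open>\<psi>\<^sup>2 v\<close>,
  along which the speed for \<open>\<rho> g\<close> is \<open>\<rho> \<psi>\<^sup>4 g(v,v)\<close>. Hence \<open>\<rho> \<psi>\<^sup>4\<close> agrees at the endpoints of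
  every non-null segment; at most two such segments connect any two points of a convex affine chart,
  and connectedness concludes.\<close>

subsection \<open>Smooth maps\<close>

text \<open>Affine charts are not part of the data: flatness means zero curvature, whereas
  \<open>pseudo_Euclidean_manifold\<close> says something about \<open>g\<close> only in affine
  charts. Their existence is therefore the main obstacle, and most of the analysis serves it. The
  equations for affine coordinates are linear, so one ball serves all initial values, and finitely
  many solutions can be combined into a coordinate map. The hybrid connection differs from
  \<open>D\<close> by a term that, on the diagonal, is a multiple of the velocity. It bends no line
  and only changes its parametrization; \<open>\<psi>\<^sup>2\<close> is the resulting speed factor,
  and the exponent 4 appears because a metric is quadratic in the velocity. A null segment has speed
  0 for every \<rho>, so it gives no information about \<rho>; this forces the detour through
  non-null segments. Since \<open>g\<close> is only locally constant on a disconnected chart domain,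
  charts are shrunk until their images are balls, which makes the domains connected and the images
  convex at once.\<close>

lemma Ck_on_cong:
  assumes "open S" "\<And>x. x \<in> S \<Longrightarrow> f x = g x"
  shows "Ck_on k S f \<longleftrightarrow> Ck_on k S g"
  using assms(2)
proof (induction k arbitrary: f g)
  case 0
  then show ?case by (simp cong: continuous_on_cong)
next
  case (Suc k)
  \<comment> \<open>The derivative at \<open>x\<close> depends on a neighbourhood of
    \<open>x\<close>; openness of \<open>S\<close> provides equality there.\<close>
  have ev: "eventually (\<lambda>y. f y = g y) (nhds x)" if "x \<in> S" for x
    using assms(1) Suc.prems that eventually_nhds by blast
  have der: "(f has_derivative d) (at x) \<longleftrightarrow> (g has_derivative d) (at x)" if "x \<in> S" for x d
  proof -
    have "f x = g x" "eventually (\<lambda>y. f y = g y) (at x)"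
      using Suc.prems that ev[OF that] by (auto simp: eventually_at_filter elim: eventually_mono)
    then show ?thesis
      using has_derivative_transform_eventually[of f d x UNIV g]
        has_derivative_transform_eventually[of g d x UNIV f]
      by (auto simp: eq_commute)
  qed
  then have "f differentiable (at x) \<longleftrightarrow> g differentiable (at x)"
    "frechet_derivative f (at x) = frechet_derivative g (at x)" if "x \<in> S" for x
    using that by (auto simp: differentiable_def frechet_derivative_def)
  moreover from this(2) have "Ck_on k S (\<lambda>x. frechet_derivative f (at x) v) \<longleftrightarrow>
      Ck_on k S (\<lambda>x. frechet_derivative g (at x) v)" for v
    by (intro Suc.IH) simp
  ultimately show ?case by simp
qed

lemma Ck_on_subset: "Ck_on k T f \<Longrightarrow> S \<subseteq> T \<Longrightarrow> Ck_on k S f"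
  by (induction k arbitrary: f) (auto intro: continuous_on_subset)

text \<open>The successor clause of \<open>Ck_on\<close> does not list the lower orders; at the
  bottom, continuity comes from differentiability. Product and chain rules need this descent, since
  their terms mix differentiated and undifferentiated factors.\<close>

lemma Ck_on_Suc_D: "Ck_on (Suc k) S f \<Longrightarrow> Ck_on k S f"
proof (induction k arbitrary: f)
  case 0
  then show ?case
    by (auto intro!: continuous_at_imp_continuous_on differentiable_imp_continuous_within)
next
  case (Suc k)
  from Suc.prems have "f differentiable (at x)" if "x \<in> S" for x
    using that by simp
  moreover have "Ck_on k S (\<lambda>x. frechet_derivative f (at x) v)" for v
    by (rule Suc.IH) (use Suc.prems in simp)
  ultimately show ?case by simp
qed

lemma Ck_on_continuous: "Ck_on k S f \<Longrightarrow> continuous_on S f"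
proof (induction k)
  case (Suc k)
  then show ?case using Ck_on_Suc_D by blast
qed simp

text \<open>Frees the closure lemmas from \<open>frechet_derivative\<close>: any explicit formula
  for the derivative may be used, because derivatives are unique and \<open>S\<close> is
  open.\<close>

lemma Ck_on_SucI:
  assumes "open S" "\<And>x. x \<in> S \<Longrightarrow> (f has_derivative f' x) (at x)"
    "\<And>v. Ck_on k S (\<lambda>x. f' x v)"
  shows "Ck_on (Suc k) S f"
proof -
  have "frechet_derivative f (at x) = f' x" if "x \<in> S" for x
    using assms(2)[OF that] by (metis frechet_derivative_at)
  then have "Ck_on k S (\<lambda>x. frechet_derivative f (at x) v)" for v
    using assms(3)[of v] Ck_on_cong[OF assms(1), of "\<lambda>x. frechet_derivative f (at x) v" "\<lambda>x. f' x v"]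
    by simp
  then show ?thesis
    using assms(2) by (auto simp: differentiable_def)
qed

lemma Ck_on_const: "Ck_on k S (\<lambda>x. c)"
  by (induction k arbitrary: c) auto

lemma Ck_on_bounded_linear:
  assumes "bounded_linear L" "open S" "Ck_on k S f"
  shows "Ck_on k S (\<lambda>x. L (f x))"
  using assms(3)
proof (induction k arbitrary: f)
  case 0
  then show ?case using linear_continuous_on_compose assms(1)
    by (auto intro: bounded_linear.continuous_on)
next
  case (Suc k)
  then have "(f has_derivative frechet_derivative f (at x)) (at x)" if "x \<in> S" for x
    using that by (auto simp: frechet_derivative_works)
  then show ?case
    using Suc by (intro Ck_on_SucI[OF assms(2) bounded_linear.has_derivative[OF assms(1)]]) auto
qed

lemma Ck_on_ident: "open S \<Longrightarrow> Ck_on k S (\<lambda>x. x)"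
proof (cases k)
  case (Suc j)
  assume "open S"
  then show ?thesis
    unfolding Suc by (intro Ck_on_SucI[where f' = "\<lambda>x v. v"]) (auto intro: Ck_on_const)
qed auto

lemma Ck_on_add:
  assumes "open S" "Ck_on k S f" "Ck_on k S g"
  shows "Ck_on k S (\<lambda>x. f x + g x)"
  using assms(2,3)
proof (induction k arbitrary: f g)
  case 0
  then show ?case by (auto intro: continuous_intros)
next
  case (Suc k)
  then have "(f has_derivative frechet_derivative f (at x)) (at x)"
    "(g has_derivative frechet_derivative g (at x)) (at x)" if "x \<in> S" for x
    using that by (auto simp: frechet_derivative_works)
  then show ?case
    using Suc by (intro Ck_on_SucI[OF assms(1) has_derivative_add]) auto
qed

lemma Ck_on_sum:
  assumes "open S" "\<And>i. i \<in> I \<Longrightarrow> Ck_on k S (f i)"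
  shows "Ck_on k S (\<lambda>x. \<Sum>i\<in>I. f i x)"
  using assms(2)
  by (induction I rule: infinite_finite_induct) (auto intro: Ck_on_const Ck_on_add assms(1))

lemma Ck_on_bounded_bilinear:
  assumes "bounded_bilinear B" "open S" "Ck_on k S f" "Ck_on k S g"
  shows "Ck_on k S (\<lambda>x. B (f x) (g x))"
  using assms(3,4)
proof (induction k arbitrary: f g)
  case 0
  then show ?case using assms(1) by (auto intro: bounded_bilinear.continuous_on)
next
  case (Suc k)
  then have "(f has_derivative frechet_derivative f (at x)) (at x)"
    "(g has_derivative frechet_derivative g (at x)) (at x)" if "x \<in> S" for x
    using that by (auto simp: frechet_derivative_works)
  moreover have "Ck_on k S f" "Ck_on k S g" using Suc.prems Ck_on_Suc_D by blast+
  ultimately show ?case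
    using Suc
    by (intro Ck_on_SucI[OF assms(2) bounded_bilinear.FDERIV[OF assms(1)]] Ck_on_add assms(2)) auto
qed

text \<open>In the chain rule the base point \<open>g x\<close> and the direction
  \<open>?E x v\<close> both move with \<open>x\<close>. Expanding the direction in the basis of the
  Euclidean codomain of \<open>g\<close> separates them: each term is a coordinate of
  \<open>?E x v\<close> times the composition \<open>?D (g x) i\<close>, to which the induction
  hypothesis applies.\<close>

lemma Ck_on_compose:
  fixes g :: "'a::real_normed_vector \<Rightarrow> 'b::euclidean_space"
  assumes "open S" "open T" "g ` S \<subseteq> T" "Ck_on k T f" "Ck_on k S g"
  shows "Ck_on k S (\<lambda>x. f (g x))"
  using assms(4,5)
proof (induction k arbitrary: f)
  case 0
  then show ?case using assms(3) by (auto intro: continuous_on_compose2)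
next
  case (Suc k)
  let ?D = "\<lambda>y. frechet_derivative f (at y)" and ?E = "\<lambda>x. frechet_derivative g (at x)"
  have f: "(f has_derivative ?D y) (at y)" if "y \<in> T" for y
    using Suc.prems that by (auto simp: frechet_derivative_works)
  have g: "(g has_derivative ?E x) (at x)" if "x \<in> S" for x
    using Suc.prems that by (auto simp: frechet_derivative_works)
  have "((\<lambda>x. f (g x)) has_derivative (\<lambda>v. \<Sum>i\<in>Basis. (?E x v \<bullet> i) *\<^sub>R ?D (g x) i)) (at x)"
    if "x \<in> S" for x
  proof -
    have gx: "g x \<in> T" using that assms(3) by auto
    have "linear (?D (g x))" using f[OF gx] by (simp add: has_derivative_linear)
    then have "?D (g x) (?E x v) = (\<Sum>i\<in>Basis. (?E x v \<bullet> i) *\<^sub>R ?D (g x) i)" for v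
      by (subst euclidean_representation[of "?E x v", symmetric])
        (simp only: linear_sum linear_scale)
    then show ?thesis
      using has_derivative_compose[OF g[OF that] f[OF gx]] by simp
  qed
  moreover have "Ck_on k S (\<lambda>x. (?E x v \<bullet> i) *\<^sub>R ?D (g x) i)" for v i
  proof (rule Ck_on_bounded_bilinear[OF bounded_bilinear_scaleR assms(1)])
    show "Ck_on k S (\<lambda>x. ?E x v \<bullet> i)"
      using Suc.prems by (intro Ck_on_bounded_linear[OF bounded_linear_inner_left assms(1)]) auto
    show "Ck_on k S (\<lambda>x. ?D (g x) i)"
      using Suc.prems Ck_on_Suc_D by (intro Suc.IH) auto
  qed
  ultimately show ?case by (intro Ck_on_SucI[OF assms(1)]) (auto intro: Ck_on_sum assms(1))
qed

lemma Ck_on_inverse: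
  fixes f :: "'a::real_normed_vector \<Rightarrow> real"
  assumes "open S" "\<And>x. x \<in> S \<Longrightarrow> f x \<noteq> 0" "Ck_on k S f"
  shows "Ck_on k S (\<lambda>x. inverse (f x))"
  using assms(3)
proof (induction k)
  case 0
  then show ?case using assms(2) by (auto intro: continuous_intros)
next
  case (Suc k)
  let ?D = "\<lambda>y. frechet_derivative f (at y)"
  have f: "(f has_derivative ?D y) (at y)" if "y \<in> S" for y
    using Suc.prems that by (auto simp: frechet_derivative_works)
  have *: "((\<lambda>x. inverse (f x)) has_derivative (\<lambda>v. - (inverse (f x) * ?D x v * inverse (f x)))) (at x)"
    if "x \<in> S" for x
    using Deriv.has_derivative_inverse[OF assms(2) f] that by blast
  \<comment> \<open>The derivative of the reciprocal contains the reciprocal itself, one order below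
    what is to be shown, so the induction hypothesis covers it.\<close>
  have inv: "Ck_on k S (\<lambda>x. inverse (f x))" using Suc Ck_on_Suc_D by blast
  show ?case
    using Suc.prems
    by (intro Ck_on_SucI[OF assms(1) *] Ck_on_bounded_linear[OF bounded_linear_minus[OF bounded_linear_ident] assms(1)]
        Ck_on_bounded_bilinear[OF bounded_bilinear_mult assms(1)] inv) auto
qed

lemma smooth_on_cong:
  "open S \<Longrightarrow> (\<And>x. x \<in> S \<Longrightarrow> f x = g x) \<Longrightarrow> smooth_on S f \<longleftrightarrow> smooth_on S g"
  using Ck_on_cong unfolding smooth_on_def by blast

lemma smooth_on_subset: "smooth_on T f \<Longrightarrow> S \<subseteq> T \<Longrightarrow> smooth_on S f"
  using Ck_on_subset unfolding smooth_on_def by blast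

lemma smooth_on_imp_continuous_on: "smooth_on S f \<Longrightarrow> continuous_on S f"
  unfolding smooth_on_def using Ck_on_continuous by blast

lemma smooth_on_has_derivative:
  "smooth_on S f \<Longrightarrow> x \<in> S \<Longrightarrow> (f has_derivative frechet_derivative f (at x)) (at x)"
  unfolding smooth_on_def by (metis Ck_on.simps(2) frechet_derivative_works)

lemma smooth_on_frechet_derivative:
  "smooth_on S f \<Longrightarrow> smooth_on S (\<lambda>x. frechet_derivative f (at x) v)"
  unfolding smooth_on_def by (metis Ck_on.simps(2))

lemma smooth_on_const: "smooth_on S (\<lambda>x. c)"
  by (simp add: smooth_on_def Ck_on_const)

lemma smooth_on_ident: "open S \<Longrightarrow> smooth_on S (\<lambda>x. x)"
  by (simp add: smooth_on_def Ck_on_ident)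

lemma smooth_on_bounded_linear:
  "bounded_linear L \<Longrightarrow> open S \<Longrightarrow> smooth_on S f \<Longrightarrow> smooth_on S (\<lambda>x. L (f x))"
  by (simp add: smooth_on_def Ck_on_bounded_linear)

lemma smooth_on_add: "open S \<Longrightarrow> smooth_on S f \<Longrightarrow> smooth_on S g \<Longrightarrow> smooth_on S (\<lambda>x. f x + g x)"
  by (simp add: smooth_on_def Ck_on_add)

lemma smooth_on_minus: "open S \<Longrightarrow> smooth_on S f \<Longrightarrow> smooth_on S (\<lambda>x. - f x)"
  by (rule smooth_on_bounded_linear[OF bounded_linear_minus[OF bounded_linear_ident]])

lemma smooth_on_diff: "open S \<Longrightarrow> smooth_on S f \<Longrightarrow> smooth_on S g \<Longrightarrow> smooth_on S (\<lambda>x. f x - g x)"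
  using smooth_on_add[of S f "\<lambda>x. - g x"] smooth_on_minus by auto

lemma smooth_on_sum:
  "open S \<Longrightarrow> (\<And>i. i \<in> I \<Longrightarrow> smooth_on S (f i)) \<Longrightarrow> smooth_on S (\<lambda>x. \<Sum>i\<in>I. f i x)"
  by (simp add: smooth_on_def Ck_on_sum)

lemma smooth_on_bounded_bilinear:
  "bounded_bilinear B \<Longrightarrow> open S \<Longrightarrow> smooth_on S f \<Longrightarrow> smooth_on S g \<Longrightarrow> smooth_on S (\<lambda>x. B (f x) (g x))"
  by (simp add: smooth_on_def Ck_on_bounded_bilinear)

lemmas smooth_on_scaleR = smooth_on_bounded_bilinear[OF bounded_bilinear_scaleR]
lemmas smooth_on_mult = smooth_on_bounded_bilinear[OF bounded_bilinear_mult]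
lemma smooth_on_compose:
  fixes g :: "'a::real_normed_vector \<Rightarrow> 'b::euclidean_space"
  assumes "open S" "open T" "g ` S \<subseteq> T" "smooth_on T f" "smooth_on S g"
  shows "smooth_on S (\<lambda>x. f (g x))"
  using assms by (auto simp: smooth_on_def intro: Ck_on_compose)

lemma smooth_on_inverse:
  fixes f :: "'a::real_normed_vector \<Rightarrow> real"
  shows "open S \<Longrightarrow> (\<And>x. x \<in> S \<Longrightarrow> f x \<noteq> 0) \<Longrightarrow> smooth_on S f \<Longrightarrow> smooth_on S (\<lambda>x. inverse (f x))"
  by (auto simp: smooth_on_def intro: Ck_on_inverse)

lemma smooth_on_power:
  fixes f :: "'a::real_normed_vector \<Rightarrow> real"
  shows "open S \<Longrightarrow> smooth_on S f \<Longrightarrow> smooth_on S (\<lambda>x. f x ^ n)"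
  by (induction n) (auto intro: smooth_on_const smooth_on_mult)

text \<open>The right-hand side of a differential equation for \<open>f\<close> inherits the regularity of \<open>f\<close>, so
  solutions are smooth by bootstrapping.\<close>
lemma smooth_on_bootstrap:
  assumes "open S" "\<And>x. x \<in> S \<Longrightarrow> (f has_derivative f' x) (at x)"
    "\<And>k v. Ck_on k S f \<Longrightarrow> Ck_on k S (\<lambda>x. f' x v)"
  shows "smooth_on S f"
proof -
  have "Ck_on k S f" for k
  proof (induction k)
    case 0
    show ?case
      using assms(2) by (auto intro!: continuous_at_imp_continuous_on has_derivative_continuous)
  next
    case (Suc k)
    show ?case by (intro Ck_on_SucI[OF assms(1,2)] assms(3) Suc)
  qed
  then show ?thesis by (simp add: smooth_on_def)
qed

subsection \<open>Flat linear systems\<close>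

text \<open>One Picard step along rays for the system \<open>D\<^sub>u Y = A(x)(u) Y\<close>. By flatness the derivative of
  the integrand splits off the exact term \<open>d/dt (t A(p)(u)(y p))\<close>, and what remains only involves
  the defect \<open>y' - A y\<close>.\<close>
lemma radial_integral_has_derivative:
  fixes A :: "'a::euclidean_space \<Rightarrow> 'a \<Rightarrow>\<^sub>L 'e::banach \<Rightarrow>\<^sub>L 'e"
  assumes B: "open B" "convex B" "x0 \<in> B"
    and A: "\<And>x. x \<in> B \<Longrightarrow> (A has_derivative blinfun_apply (A' x)) (at x)" "continuous_on B A'"
    and flat: "\<And>x u v z. x \<in> B \<Longrightarrow> A' x u v z + A x v (A x u z) = A' x v u z + A x u (A x v z)"
    and y: "\<And>x. x \<in> B \<Longrightarrow> (y has_derivative blinfun_apply (y' x)) (at x)" "continuous_on B y'"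
  defines "p \<equiv> \<lambda>x t. x0 + t *\<^sub>R (x - x0)"
    and "e \<equiv> \<lambda>x u. y' x u - A x u (y x)"
  shows "\<exists>d. continuous_on B d \<and>
    (\<forall>x\<in>B. ((\<lambda>x. integral {0..1} (\<lambda>t. A (p x t) (x - x0) (y (p x t)))) has_derivative blinfun_apply (d x)) (at x) \<and>
      (\<forall>u. ((\<lambda>t. t *\<^sub>R (A (p x t) (x - x0) (e (p x t) u) - A (p x t) u (e (p x t) (x - x0))))
         has_integral d x u - A x u (y x)) {0..1}))"
proof -
  have pB: "p x t \<in> B" if "x \<in> B" "t \<in> {0..1}" for x t
  proof -
    have "p x t = (1 - t) *\<^sub>R x0 + t *\<^sub>R x" by (simp add: p_def algebra_simps)
    then show ?thesis using B that by (auto simp: convex_alt)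
  qed
  have contA: "continuous_on B A" and conty: "continuous_on B y"
    using A(1) y(1) has_derivative_continuous by (blast intro: continuous_at_imp_continuous_on)+
  \<comment> \<open>\<open>G x t u\<close> is the derivative of the integrand in \<open>x\<close> in
    direction \<open>u\<close>; the factors \<open>t\<close> come from the derivative of
    \<open>p x t\<close> in \<open>x\<close>.\<close>
  define G where "G x t u =
    t *\<^sub>R A' (p x t) u (x - x0) (y (p x t)) + A (p x t) u (y (p x t)) + t *\<^sub>R A (p x t) (x - x0) (y' (p x t) u)" for x t u
  have blG: "bounded_linear (G x t)" for x t
    unfolding G_def by (intro bounded_linear_intros)
  \<comment> \<open>Differentiation under the integral sign is applied with operator-valued
    derivatives, hence \<open>Blinfun\<close>.\<close>
  define d where "d x = integral {0..1} (\<lambda>t. Blinfun (G x t))" for x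
  have contp: "continuous_on (B \<times> {0..1}) (\<lambda>z. p (fst z) (snd z))"
    unfolding p_def by (intro continuous_intros)
  have pimg: "(\<lambda>z. p (fst z) (snd z)) ` (B \<times> {0..1}) \<subseteq> B" using pB by auto
  note cp = continuous_on_compose2[OF _ contp pimg]
  have contG: "continuous_on (B \<times> {0..1}) (\<lambda>(x, t). Blinfun (G x t))"
  proof (rule continuous_on_blinfun_componentwise)
    fix i :: 'a
    show "continuous_on (B \<times> {0..1}) (\<lambda>z. blinfun_apply (case z of (x, t) \<Rightarrow> Blinfun (G x t)) i)"
      unfolding split_beta bounded_linear_Blinfun_apply[OF blG] G_def
      by (intro continuous_intros cp[OF contA] cp[OF A(2)] cp[OF conty] cp[OF y(2)])
  qed
  have slice: "continuous_on {0..1} (\<lambda>t. f (x, t))" if "continuous_on (B \<times> {0..1}) f" "x \<in> B" for f x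
    by (rule continuous_on_compose2[OF that(1)]) (use that(2) in \<open>auto intro!: continuous_intros\<close>)
  have der: "((\<lambda>x. A (p x t) (x - x0) (y (p x t))) has_derivative blinfun_apply (Blinfun (G x t))) (at x within B)"
    if "x \<in> B" "t \<in> cbox 0 1" for x t
  proof -
    have pd: "((\<lambda>x. p x t) has_derivative (\<lambda>u. t *\<^sub>R u)) (at x)"
      unfolding p_def by (auto intro!: derivative_eq_intros)
    have px: "p x t \<in> B" using pB that by auto
    have a: "((\<lambda>x. A (p x t)) has_derivative (\<lambda>u. A' (p x t) (t *\<^sub>R u))) (at x)"
      by (rule has_derivative_compose[OF pd A(1)[OF px]])
    have b: "((\<lambda>x. y (p x t)) has_derivative (\<lambda>u. y' (p x t) (t *\<^sub>R u))) (at x)"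
      by (rule has_derivative_compose[OF pd y(1)[OF px]])
    have c: "((\<lambda>x. x - x0) has_derivative (\<lambda>u. u)) (at x)"
      by (auto intro!: derivative_eq_intros)
    have "((\<lambda>x. A (p x t) (x - x0) (y (p x t))) has_derivative G x t) (at x)"
      by (rule has_derivative_eq_rhs[OF blinfun.FDERIV[OF blinfun.FDERIV[OF a c] b]])
        (simp add: G_def blinfun.bilinear_simps fun_eq_iff algebra_simps)
    then show ?thesis
      by (simp add: bounded_linear_Blinfun_apply[OF blG] has_derivative_at_withinI)
  qed
  have dd: "((\<lambda>x. integral {0..1} (\<lambda>t. A (p x t) (x - x0) (y (p x t)))) has_derivative blinfun_apply (d x)) (at x)"
    if "x \<in> B" for x
  proof -
    have "((\<lambda>x. integral (cbox 0 1) (\<lambda>t. A (p x t) (x - x0) (y (p x t)))) has_derivative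
        integral (cbox 0 1) (\<lambda>t. Blinfun (G x t))) (at x within B)"
    proof (rule leibniz_rule[where fx = "\<lambda>x t. Blinfun (G x t)"])
      fix x assume "x \<in> B"
      have "continuous_on (B \<times> {0..1}) (\<lambda>z. A (p (fst z) (snd z)) (fst z - x0) (y (p (fst z) (snd z))))"
        by (intro continuous_intros cp[OF contA] cp[OF conty])
      from slice[OF this \<open>x \<in> B\<close>]
      show "(\<lambda>t. A (p x t) (x - x0) (y (p x t))) integrable_on cbox 0 1"
        by (auto intro!: integrable_continuous_real)
    next
      show "continuous_on (B \<times> cbox 0 1) (\<lambda>(x, t). Blinfun (G x t))"
        using contG by (simp only: cbox_interval)
    qed (fact der that B(2))+
    then show ?thesis
      unfolding at_within_open[OF that B(1)] d_def cbox_interval .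
  qed
  have contd: "continuous_on B d"
    using integral_continuous_on_param[of B "0::real" 1 "\<lambda>x t. Blinfun (G x t)"] contG
    by (simp add: d_def[abs_def])
  have di: "((\<lambda>t. t *\<^sub>R (A (p x t) (x - x0) (e (p x t) u) - A (p x t) u (e (p x t) (x - x0))))
         has_integral d x u - A x u (y x)) {0..1}" if x: "x \<in> B" for x u
  proof -
    have "((\<lambda>t. Blinfun (G x t)) has_integral d x) {0..1}"
      using slice[OF contG x] unfolding d_def
      by (auto intro!: integrable_integral integrable_continuous_real)
    from has_integral_linear[OF this blinfun.bounded_linear_left[of u]]
    have 1: "((\<lambda>t. G x t u) has_integral d x u) {0..1}"
      by (simp add: o_def bounded_linear_Blinfun_apply[OF blG])
    let ?h = "x - x0"
    let ?F = "\<lambda>t. t *\<^sub>R A (p x t) u (y (p x t))"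
    let ?F' = "\<lambda>t. A (p x t) u (y (p x t)) +
      t *\<^sub>R (A' (p x t) ?h u (y (p x t)) + A (p x t) u (y' (p x t) ?h))"
    have "(?F' has_integral ?F 1 - ?F 0) {0..1}"
    proof (rule fundamental_theorem_of_calculus)
      fix t :: real assume t: "t \<in> {0..1}"
      have pd: "((\<lambda>t. p x t) has_derivative (\<lambda>s. s *\<^sub>R ?h)) (at t)"
        unfolding p_def by (auto intro!: derivative_eq_intros)
      have px: "p x t \<in> B" using pB t x by auto
      have a: "((\<lambda>t. A (p x t)) has_derivative (\<lambda>s. A' (p x t) (s *\<^sub>R ?h))) (at t)"
        by (rule has_derivative_compose[OF pd A(1)[OF px]])
      have b: "((\<lambda>t. y (p x t)) has_derivative (\<lambda>s. y' (p x t) (s *\<^sub>R ?h))) (at t)"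
        by (rule has_derivative_compose[OF pd y(1)[OF px]])
      have "(?F has_derivative (\<lambda>s. s *\<^sub>R ?F' t)) (at t)"
        by (rule has_derivative_eq_rhs[OF has_derivative_scaleR[OF has_derivative_ident
                blinfun.FDERIV[OF blinfun.FDERIV[OF a has_derivative_const[of u]] b]]])
          (simp add: blinfun.bilinear_simps fun_eq_iff algebra_simps)
      then show "(?F has_vector_derivative ?F' t) (at t within {0..1})"
        by (simp add: has_vector_derivative_def has_derivative_at_withinI)
    qed simp
    then have 2: "(?F' has_integral A x u (y x)) {0..1}" by (simp add: p_def)
    show ?thesis
    proof (rule has_integral_eq[OF _ has_integral_diff[OF 1 2]])
      fix t :: real assume "t \<in> {0..1}"
      then have px: "p x t \<in> B" using pB x by auto
      \<comment> \<open>Flatness trades \<open>A' u h - A' h u\<close> for a commutator of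
        \<open>A u\<close> and \<open>A h\<close>, which is absorbed by writing \<open>y'\<close> as
        \<open>e\<close> plus \<open>A y\<close>.\<close>
      show "G x t u - ?F' t = t *\<^sub>R (A (p x t) ?h (e (p x t) u) - A (p x t) u (e (p x t) ?h))"
        using arg_cong[OF flat[OF px, of u ?h "y (p x t)"], of "scaleR t"]
        by (simp add: G_def e_def blinfun.bilinear_simps algebra_simps)
    qed
  qed
  show ?thesis
    using contd dd di by blast
qed

text \<open>The equation can always be solved along rays from \<open>x0\<close>; flatness makes it
  hold transversally too. Rather than checking this afterwards, the Picard iteration keeps track of
  the full derivative: its defect tends to 0 uniformly, so the derivatives converge to the
  right-hand side at the limit. The radius does not depend on \<open>y0\<close> because the system
  is linear.\<close>

lemma flat_linear_system_solution:
  fixes A :: "'a::euclidean_space \<Rightarrow> 'a \<Rightarrow>\<^sub>L 'e::banach \<Rightarrow>\<^sub>L 'e"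
  assumes S: "open S" "x0 \<in> S"
    and A: "\<And>x. x \<in> S \<Longrightarrow> (A has_derivative blinfun_apply (A' x)) (at x)" "continuous_on S A'"
    and flat: "\<And>x u v z. x \<in> S \<Longrightarrow> A' x u v z + A x v (A x u z) = A' x v u z + A x u (A x v z)"
  obtains r where "r > 0" "ball x0 r \<subseteq> S"
    "\<And>y0. \<exists>Y. Y x0 = y0 \<and> (\<forall>x\<in>ball x0 r. (Y has_derivative (\<lambda>u. A x u (Y x))) (at x))"
proof -
  obtain r0 where r0: "r0 > 0" "cball x0 r0 \<subseteq> S"
    using S open_contains_cball by blast
  have "continuous_on (cball x0 r0) A"
    using A(1) r0 has_derivative_continuous by (blast intro: continuous_at_imp_continuous_on)
  then have "bounded (A ` cball x0 r0)"
    by (intro compact_imp_bounded compact_continuous_image compact_cball)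
  then obtain C where C: "C > 0" "\<And>x. x \<in> cball x0 r0 \<Longrightarrow> norm (A x) \<le> C"
    unfolding bounded_pos by blast
  \<comment> \<open>\<open>C * r \<le> 1 / 4\<close> makes the radial Picard operator a contraction
    with factor 1/4, and bounds each of the two terms of the new defect by a quarter of the old
    defect.\<close>
  define r where "r = min r0 (1 / (4 * C))"
  define B where "B = ball x0 r"
  have r: "r > 0" "C * r \<le> 1 / 4"
    using r0 C by (auto simp: r_def min_def field_simps)
  have BS: "B \<subseteq> S" and B: "open B" "convex B" "x0 \<in> B"
    using r0 r by (auto simp: B_def r_def)
  have Cx: "norm (A x) \<le> C" "norm (x - x0) \<le> r" if "x \<in> B" for x
    using that C by (auto simp: B_def r_def dist_norm norm_minus_commute)
  have Au: "norm (A x u z) \<le> C * norm u * norm z" if "x \<in> B" for x u z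
  proof -
    have "norm (A x u z) \<le> norm (A x) * norm u * norm z"
      by (intro order_trans[OF norm_blinfun] mult_right_mono norm_blinfun norm_ge_zero)
    also have "\<dots> \<le> C * norm u * norm z"
      using Cx(1)[OF that] by (intro mult_right_mono) auto
    finally show ?thesis .
  qed
  have Ah: "norm (A q (x - x0) z) \<le> 1/4 * norm z" if "x \<in> B" "q \<in> B" for x q z
  proof -
    have "norm (A q (x - x0) z) \<le> C * norm (x - x0) * norm z" by (rule Au[OF that(2)])
    also have "\<dots> \<le> C * r * norm z"
      using Cx(2)[OF that(1)] C by (intro mult_right_mono mult_left_mono) auto
    also have "\<dots> \<le> 1/4 * norm z" using r by (intro mult_right_mono) auto
    finally show ?thesis .
  qed
  define p where "p x t = x0 + t *\<^sub>R (x - x0)" for x and t :: real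
  have pB: "p x t \<in> B" if "x \<in> B" "t \<in> {0..1}" for x t
  proof -
    have "p x t = (1 - t) *\<^sub>R x0 + t *\<^sub>R x" by (simp add: p_def algebra_simps)
    then show ?thesis using B that by (auto simp: convex_alt)
  qed
  have contA: "continuous_on B A"
    using A(1) BS has_derivative_continuous by (blast intro: continuous_at_imp_continuous_on)
  have AB: "\<And>x. x \<in> B \<Longrightarrow> (A has_derivative blinfun_apply (A' x)) (at x)" "continuous_on B A'"
    and flatB: "\<And>x u v z. x \<in> B \<Longrightarrow> A' x u v z + A x v (A x u z) = A' x v u z + A x u (A x v z)"
    using A flat BS by (auto intro: continuous_on_subset)
  have "\<exists>Y. Y x0 = y0 \<and> (\<forall>x\<in>ball x0 r. (Y has_derivative (\<lambda>u. A x u (Y x))) (at x))" for y0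
  proof -
    define I where "I y x = integral {0..1} (\<lambda>t. A (p x t) (x - x0) (y (p x t)))" for y :: "'a \<Rightarrow> 'e" and x
    define Y where "Y = rec_nat (\<lambda>x. y0) (\<lambda>n y x. y0 + I y x)"
    have Y: "Y 0 = (\<lambda>x. y0)" "Y (Suc n) = (\<lambda>x. y0 + I (Y n) x)" for n
      by (simp_all add: Y_def)
    have Y_diff: "Y (Suc m) x - Y (Suc n) x = I (Y m) x - I (Y n) x" for m n x
      by (simp add: Y)
    \<comment> \<open>The factor 4 is chosen so that replacing \<open>Y n\<close> by
      \<open>Y (Suc n)\<close> in the defect costs \<open>K / 4\<close> times
      \<open>(1/2)^n\<close>.\<close>
    define K where "K = 4 * C * norm y0"
    have K: "K \<ge> 0" using C by (simp add: K_def)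
    \<comment> \<open>The new derivative is compared with the old iterate \<open>Y n\<close>; the
      two terms of the remainder contribute \<open>b / 4\<close> each.\<close>
    have step: "\<exists>d'. continuous_on B d' \<and> (\<forall>x\<in>B. (Y (Suc n) has_derivative blinfun_apply (d' x)) (at x) \<and>
        (\<forall>u. norm (d' x u - A x u (Y n x)) \<le> b / 2 * norm u))"
      if d: "continuous_on B d" "\<And>x. x \<in> B \<Longrightarrow> (Y n has_derivative blinfun_apply (d x)) (at x)"
        and b: "\<And>x u. x \<in> B \<Longrightarrow> norm (d x u - A x u (Y n x)) \<le> b * norm u" "b \<ge> 0" for n d b
    proof -
      obtain d' where d': "continuous_on B d'"
        "\<And>x. x \<in> B \<Longrightarrow> (I (Y n) has_derivative blinfun_apply (d' x)) (at x)"
        "\<And>x u. x \<in> B \<Longrightarrow> ((\<lambda>t. t *\<^sub>R (A (p x t) (x - x0) (d (p x t) u - A (p x t) u (Y n (p x t))) -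
            A (p x t) u (d (p x t) (x - x0) - A (p x t) (x - x0) (Y n (p x t)))))
           has_integral d' x u - A x u (Y n x)) {0..1}"
        using radial_integral_has_derivative[OF B AB flatB d(2,1)]
        unfolding I_def[abs_def] p_def by blast
      have "norm (d' x u - A x u (Y n x)) \<le> b / 2 * norm u" if x: "x \<in> B" for x u
      proof -
        have "norm (d' x u - A x u (Y n x)) \<le> b / 2 * norm u * measure lborel (cbox 0 (1::real))"
        proof (rule has_integral_bound[OF _ d'(3)[OF x, of u, folded cbox_interval]])
          show "0 \<le> b / 2 * norm u" using b by simp
          fix t :: real assume "t \<in> cbox 0 1"
          then have t: "t \<in> {0..1}" by simp
          note q = pB[OF x t]
          let ?q = "p x t" and ?h = "x - x0"
          have "norm (A ?q ?h (d ?q u - A ?q u (Y n ?q))) \<le> 1/4 * (b * norm u)"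
            using b(1)[OF q, of u] by (intro order_trans[OF Ah[OF x q]] mult_left_mono) auto
          moreover have "norm (A ?q u (d ?q ?h - A ?q ?h (Y n ?q))) \<le> 1/4 * (b * norm u)"
          proof -
            have "norm (A ?q u (d ?q ?h - A ?q ?h (Y n ?q))) \<le> C * norm u * (b * norm ?h)"
              using b(1)[OF q, of ?h] C by (intro order_trans[OF Au[OF q]] mult_left_mono) auto
            also have "\<dots> \<le> C * norm u * (b * r)"
              using Cx(2)[OF x] C b by (intro mult_left_mono) auto
            also have "\<dots> = C * r * (b * norm u)" by simp
            also have "\<dots> \<le> 1/4 * (b * norm u)" using r b by (intro mult_right_mono) auto
            finally show ?thesis .
          qed
          ultimately have "norm (A ?q ?h (d ?q u - A ?q u (Y n ?q)) - A ?q u (d ?q ?h - A ?q ?h (Y n ?q))) \<le> b / 2 * norm u"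
            by (intro order_trans[OF norm_triangle_ineq4]) simp
          then have "t * norm (A ?q ?h (d ?q u - A ?q u (Y n ?q)) - A ?q u (d ?q ?h - A ?q ?h (Y n ?q))) \<le> 1 * (b / 2 * norm u)"
            using t by (intro mult_mono) auto
          then show "norm (t *\<^sub>R (A ?q ?h (d ?q u - A ?q u (Y n ?q)) - A ?q u (d ?q ?h - A ?q ?h (Y n ?q)))) \<le> b / 2 * norm u"
            using t by simp
        qed
        then show ?thesis by simp
      qed
      then show ?thesis
        using d' unfolding Y by (intro exI[of _ d']) (auto intro!: derivative_eq_intros)
    qed
    have I_diff: "norm (I y x - I z x) \<le> 1/4 * b"
      if c: "continuous_on B y" "continuous_on B z" and b: "\<And>x. x \<in> B \<Longrightarrow> norm (y x - z x) \<le> b"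
        and x: "x \<in> B" for y z b x
    proof -
      have cp: "continuous_on {0..1} (p x)" "p x ` {0..1} \<subseteq> B"
        using pB[OF x] by (auto simp: p_def[abs_def] intro!: continuous_intros)
      have int: "((\<lambda>t. A (p x t) (x - x0) (w (p x t))) has_integral I w x) {0..1}"
        if "continuous_on B w" for w
        unfolding I_def
        by (intro integrable_integral integrable_continuous_real continuous_intros
            continuous_on_compose2[OF contA cp] continuous_on_compose2[OF that cp])
      have "norm (I y x - I z x) \<le> 1/4 * b * measure lborel (cbox 0 (1::real))"
      proof (rule has_integral_bound[OF _ has_integral_diff[OF int[OF c(1)] int[OF c(2)], folded cbox_interval]])
        show "0 \<le> 1/4 * b" using order_trans[OF norm_ge_zero b[OF x]] by simp
        fix t :: real assume "t \<in> cbox 0 1"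
        then have q: "p x t \<in> B" using pB[OF x] by simp
        show "norm (A (p x t) (x - x0) (y (p x t)) - A (p x t) (x - x0) (z (p x t))) \<le> 1/4 * b"
          using Ah[OF x q, of "y (p x t) - z (p x t)"] b[OF q] by (simp add: blinfun.bilinear_simps)
      qed
      then show ?thesis by simp
    qed
    \<comment> \<open>The defect rate rests on
      \<open>(3/4)^n / 2 + (3/4)^n / 4 = (3/4)^Suc n\<close>: the half comes from
      \<open>step\<close>, the quarter from passing from \<open>Y n\<close> to
      \<open>Y (Suc n)\<close>. The rate 1/2 for the increments is weaker than the contraction gives
      and is dominated by 3/4.\<close>
    have main: "\<exists>d. continuous_on B d \<and> (\<forall>x\<in>B. (Y n has_derivative blinfun_apply (d x)) (at x) \<and>
        (\<forall>u. norm (d x u - A x u (Y n x)) \<le> K * (3/4)^n * norm u) \<and>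
        norm (Y (Suc n) x - Y n x) \<le> (1/2)^n * norm y0)" for n
    proof (induction n)
      case 0
      have "norm (A x u y0) \<le> K * norm u" if "x \<in> B" for x u
      proof -
        have "norm (A x u y0) \<le> C * norm u * norm y0" by (rule Au[OF that])
        also have "\<dots> \<le> K * norm u" using C by (simp add: K_def)
        finally show ?thesis .
      qed
      moreover have "norm (I (\<lambda>x. y0) x) \<le> norm y0" if "x \<in> B" for x
      proof -
        have "norm (I (\<lambda>x. y0) x) \<le> 1/4 * norm y0"
          using I_diff[of "\<lambda>x. y0" "\<lambda>x. 0" "norm y0" x] that by (simp add: I_def)
        then show ?thesis using norm_ge_zero[of y0] by linarith
      qed
      ultimately show ?case by (intro exI[of _ "\<lambda>x. 0"]) (simp add: Y)
    next
      case (Suc n)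
      then obtain d where d: "continuous_on B d" "\<And>x. x \<in> B \<Longrightarrow> (Y n has_derivative blinfun_apply (d x)) (at x)"
        "\<And>x u. x \<in> B \<Longrightarrow> norm (d x u - A x u (Y n x)) \<le> K * (3/4)^n * norm u"
        "\<And>x. x \<in> B \<Longrightarrow> norm (Y (Suc n) x - Y n x) \<le> (1/2)^n * norm y0" by blast
      obtain d' where d': "continuous_on B d'"
        "\<And>x. x \<in> B \<Longrightarrow> (Y (Suc n) has_derivative blinfun_apply (d' x)) (at x)"
        "\<And>x u. x \<in> B \<Longrightarrow> norm (d' x u - A x u (Y n x)) \<le> K * (3/4)^n / 2 * norm u"
        using step[OF d(1-3)] K by auto
      have "norm (d' x u - A x u (Y (Suc n) x)) \<le> K * (3/4)^Suc n * norm u" if x: "x \<in> B" for x u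
      proof -
        have "norm (A x u (Y n x - Y (Suc n) x)) \<le> C * norm u * norm (Y n x - Y (Suc n) x)" by (rule Au[OF x])
        also have "\<dots> \<le> C * norm u * ((1/2)^n * norm y0)"
          using d(4)[OF x] C by (intro mult_left_mono) (auto simp: norm_minus_commute)
        also have "\<dots> = K / 4 * norm u * (1/2)^n" by (simp add: K_def)
        also have "\<dots> \<le> K / 4 * norm u * (3/4)^n"
          using K by (intro mult_left_mono power_mono) auto
        finally have le: "norm (A x u (Y n x - Y (Suc n) x)) \<le> K / 4 * norm u * (3/4)^n" .
        have eq: "d' x u - A x u (Y (Suc n) x) = (d' x u - A x u (Y n x)) + A x u (Y n x - Y (Suc n) x)"
          by (simp add: blinfun.bilinear_simps)
        have "norm (d' x u - A x u (Y (Suc n) x)) \<le> K * (3/4)^n / 2 * norm u + K / 4 * norm u * (3/4)^n"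
          unfolding eq by (rule norm_triangle_mono[OF d'(3)[OF x] le])
        then show ?thesis by (simp add: algebra_simps)
      qed
      moreover have "norm (Y (Suc (Suc n)) x - Y (Suc n) x) \<le> (1/2)^Suc n * norm y0" if x: "x \<in> B" for x
      proof -
        have "continuous_on B (Y n)" "continuous_on B (Y (Suc n))"
          using d(2) d'(2) has_derivative_continuous by (blast intro: continuous_at_imp_continuous_on)+
        then have "norm (I (Y (Suc n)) x - I (Y n) x) \<le> 1/4 * ((1/2)^n * norm y0)"
          using I_diff d(4) x by blast
        moreover have "0 \<le> (1/2)^n * norm y0" by simp
        ultimately have "norm (I (Y (Suc n)) x - I (Y n) x) \<le> 1/2 * ((1/2)^n * norm y0)" by linarith
        then show ?thesis unfolding Y_diff by simp
      qed
      ultimately show ?case using d' by blast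
    qed
    then obtain d where d: "\<And>n x. x \<in> B \<Longrightarrow> (Y n has_derivative blinfun_apply (d n x)) (at x)"
      "\<And>n x u. x \<in> B \<Longrightarrow> norm (d n x u - A x u (Y n x)) \<le> K * (3/4)^n * norm u"
      "\<And>n x. x \<in> B \<Longrightarrow> norm (Y (Suc n) x - Y n x) \<le> (1/2)^n * norm y0"
      by metis
    \<comment> \<open>The bound is the closed form of the geometric sum of the increments.\<close>
    have tail: "norm (Y (n + m) x - Y n x) \<le> 2 * norm y0 * ((1/2)^n - (1/2)^(n + m))" if x: "x \<in> B" for n m x
    proof (induction m)
      case (Suc m)
      have eq: "Y (n + Suc m) x - Y n x = (Y (Suc (n + m)) x - Y (n + m) x) + (Y (n + m) x - Y n x)" by simp
      have "norm (Y (n + Suc m) x - Y n x) \<le> (1/2)^(n+m) * norm y0 + 2 * norm y0 * ((1/2)^n - (1/2)^(n + m))"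
        unfolding eq by (rule norm_triangle_mono[OF d(3)[OF x] Suc])
      then show ?case by (simp add: algebra_simps)
    qed simp
    have tail2: "norm (Y (n + m) x - Y n x) \<le> 2 * norm y0 * (1/2)^n" if x: "x \<in> B" for n m x
      by (rule order_trans[OF tail[OF x]]) (intro mult_left_mono, auto)
    have half: "(\<lambda>n. c * (1/2)^n) \<longlonglongrightarrow> 0" "(\<lambda>n. c * (3/4)^n) \<longlonglongrightarrow> 0" for c :: real
      by (intro tendsto_mult_right_zero LIMSEQ_power_zero; simp)+
    have "\<exists>l. (\<lambda>n. Y n x) \<longlonglongrightarrow> l" if x: "x \<in> B" for x
    proof -
      have "Cauchy (\<lambda>n. Y n x)"
      proof (rule CauchyI')
        fix e :: real assume "e > 0"
        then obtain N where N: "2 * norm y0 * (1/2)^N < e / 2"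
          using order_tendstoD(2)[OF half(1)[of "2 * norm y0"], of "e / 2"]
          by (auto simp: eventually_sequentially)
        have "norm (Y m x - Y n x) < e" if "m \<ge> N" "n > m" for m n
        proof -
          have "norm (Y m x - Y N x) < e / 2" "norm (Y n x - Y N x) < e / 2"
            using tail2[OF x, of N "m - N"] tail2[OF x, of N "n - N"] N that by auto
          then show ?thesis by (metis dist_norm dist_triangle_half_l)
        qed
        then show "\<exists>M. \<forall>m\<ge>M. \<forall>n>m. dist (Y m x) (Y n x) < e" by (auto simp: dist_norm)
      qed
      then show ?thesis by (simp add: Cauchy_convergent_iff convergent_def)
    qed
    then obtain L where L: "\<And>x. x \<in> B \<Longrightarrow> (\<lambda>n. Y n x) \<longlonglongrightarrow> L x" by metis
    have YL: "norm (Y n x - L x) \<le> 2 * norm y0 * (1/2)^n" if x: "x \<in> B" for n x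
    proof (rule tendsto_upperbound)
      show "(\<lambda>m. norm (Y n x - Y (n + m) x)) \<longlonglongrightarrow> norm (Y n x - L x)"
        using LIMSEQ_ignore_initial_segment[OF L[OF x], of n] by (intro tendsto_intros) (simp add: add.commute)
    qed (use tail2[OF x] in \<open>auto simp: norm_minus_commute\<close>)
    \<comment> \<open>The defect tends to 0 and \<open>Y n\<close> tends to \<open>L\<close>, both
      uniformly on \<open>B\<close>, so the derivatives tend uniformly to
      \<open>A x h (L x)\<close>; the limit function turns out to be \<open>L\<close>
      itself.\<close>
    have "\<exists>g. \<forall>x\<in>B. (\<lambda>n. Y n x) \<longlonglongrightarrow> g x \<and> (g has_derivative (\<lambda>u. A x u (L x))) (at x within B)"
    proof (rule has_derivative_sequence[where f = Y and f' = "\<lambda>n x. blinfun_apply (d n x)"])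
      show "(Y n has_derivative blinfun_apply (d n x)) (at x within B)" if "x \<in> B" for n x
        using d(1)[OF that] by (rule has_derivative_at_withinI)
      fix e :: real assume "e > 0"
      have "(\<lambda>n. K * (3/4)^n + C * (2 * norm y0) * (1/2)^n) \<longlonglongrightarrow> 0 + 0"
        by (intro tendsto_add half)
      then have "\<forall>\<^sub>F n in sequentially. K * (3/4)^n + C * (2 * norm y0) * (1/2)^n < e"
        by (rule order_tendstoD) (use \<open>e > 0\<close> in simp)
      then show "\<forall>\<^sub>F n in sequentially. \<forall>x\<in>B. \<forall>h. norm (d n x h - A x h (L x)) \<le> e * norm h"
      proof (rule eventually_mono)
        fix n assume n: "K * (3/4)^n + C * (2 * norm y0) * (1/2)^n < e"
        show "\<forall>x\<in>B. \<forall>h. norm (d n x h - A x h (L x)) \<le> e * norm h"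
        proof (intro ballI allI)
          fix x h assume x: "x \<in> B"
          have le: "norm (A x h (Y n x - L x)) \<le> C * norm h * (2 * norm y0 * (1/2)^n)"
            using YL[OF x, of n] C by (intro order_trans[OF Au[OF x]] mult_left_mono) auto
          have eq: "d n x h - A x h (L x) = (d n x h - A x h (Y n x)) + A x h (Y n x - L x)"
            by (simp add: blinfun.bilinear_simps)
          have "norm (d n x h - A x h (L x)) \<le> K * (3/4)^n * norm h + C * norm h * (2 * norm y0 * (1/2)^n)"
            unfolding eq by (rule norm_triangle_mono[OF d(2)[OF x] le])
          also have "\<dots> = (K * (3/4)^n + C * (2 * norm y0) * (1/2)^n) * norm h"
            by (simp add: algebra_simps)
          also have "\<dots> \<le> e * norm h" using n by (intro mult_right_mono) auto
          finally show "norm (d n x h - A x h (L x)) \<le> e * norm h" .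
        qed
      qed
    qed (use B L[OF B(3)] in auto)
    then obtain g where g: "\<And>x. x \<in> B \<Longrightarrow> (\<lambda>n. Y n x) \<longlonglongrightarrow> g x"
      "\<And>x. x \<in> B \<Longrightarrow> (g has_derivative (\<lambda>u. A x u (L x))) (at x within B)" by blast
    have gL: "g x = L x" if "x \<in> B" for x
      using g(1)[OF that] L[OF that] LIMSEQ_unique by blast
    \<comment> \<open>At \<open>x0\<close> the ray is a point, so the Picard integral vanishes and
      every iterate keeps the initial value.\<close>
    have "Y n x0 = y0" for n
      by (cases n) (simp_all add: Y I_def)
    then have "g x0 = y0" using g(1)[OF B(3)] LIMSEQ_unique[of "\<lambda>n. y0"] by simp
    moreover have "\<forall>x\<in>B. (g has_derivative (\<lambda>u. A x u (g x))) (at x)"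
      using g(2) by (simp add: at_within_open[OF _ B(1)] gL)
    ultimately show ?thesis unfolding B_def by (intro exI[of _ g] conjI)
  qed
  then show ?thesis
    using that[OF r(1)] BS unfolding B_def by simp
qed

section \<open>Smooth solutions of flat linear systems\<close>

text \<open>The operator is the sum of the rank-one operators sending \<open>h\<close> to
  \<open>(h \<bullet> i) *\<^sub>R f x i\<close>, each the image of \<open>f x i\<close> under a
  fixed linear map. This lifts smoothness of the values to smoothness in operator norm.\<close>

lemma smooth_on_blinfun:
  fixes f :: "'c::real_normed_vector \<Rightarrow> 'a::euclidean_space \<Rightarrow>\<^sub>L 'b::real_normed_vector"
  assumes "open S" "\<And>i. i \<in> Basis \<Longrightarrow> smooth_on S (\<lambda>x. f x i)"
  shows "smooth_on S f"
proof -
  have "f = (\<lambda>x. \<Sum>i\<in>Basis. blinfun_scaleR_left (f x i) o\<^sub>L blinfun_inner_left i)"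
  proof (intro ext blinfun_euclidean_eqI)
    fix x and j :: 'a assume "j \<in> Basis"
    then show "f x j = (\<Sum>i\<in>Basis. blinfun_scaleR_left (f x i) o\<^sub>L blinfun_inner_left i) j"
      by (simp add: blinfun.sum_left inner_Basis if_distrib[of "\<lambda>c. c *\<^sub>R _"] cong: if_cong)
  qed
  moreover have "smooth_on S (\<lambda>x. \<Sum>i\<in>Basis. blinfun_scaleR_left (f x i) o\<^sub>L blinfun_inner_left i)"
    using assms
    by (intro smooth_on_sum smooth_on_bounded_linear[where L = "\<lambda>z. blinfun_scaleR_left z o\<^sub>L _"] bounded_linear_intros) auto
  ultimately show ?thesis by simp
qed

text \<open>The form needed in geometry: the coefficients are plain bilinear maps instead of
  operators, and the solutions are smooth. The quantifier over \<open>y0\<close> stays in the object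
  logic so that solutions for all initial values can be chosen at once.\<close>

lemma flat_linear_system_smooth_solution:
  fixes a :: "'a::euclidean_space \<Rightarrow> 'a \<Rightarrow> 'e::euclidean_space \<Rightarrow> 'e"
  assumes S: "open S" "x0 \<in> S"
    and bil: "\<And>x. x \<in> S \<Longrightarrow> bilinear (a x)"
    and smooth: "\<And>u z. smooth_on S (\<lambda>x. a x u z)"
    and flat: "\<And>x u v z. x \<in> S \<Longrightarrow>
      frechet_derivative (\<lambda>x. a x v z) (at x) u + a x v (a x u z) =
      frechet_derivative (\<lambda>x. a x u z) (at x) v + a x u (a x v z)"
  obtains r where "r > 0" "ball x0 r \<subseteq> S"
    "\<forall>y0. \<exists>Y. Y x0 = y0 \<and> smooth_on (ball x0 r) Y \<and>
      (\<forall>x\<in>ball x0 r. (Y has_derivative (\<lambda>u. a x u (Y x))) (at x))"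
proof -
  \<comment> \<open>\<open>A\<close> represents \<open>a\<close> only on \<open>S\<close>, since
    outside \<open>S\<close> the map \<open>a x\<close> may fail to be bilinear.\<close>
  define A where "A x = Blinfun (bounded_bilinear.prod_right (a x))" for x
  have A: "A x u z = a x u z" if "x \<in> S" for x u z
  proof -
    interpret bounded_bilinear "a x" using bil[OF that] bilinear_conv_bounded_bilinear by blast
    show ?thesis by (simp add: A_def bounded_linear_Blinfun_apply[OF bounded_linear_prod_right])
  qed
  have smA: "smooth_on S A"
    using smooth A by (intro smooth_on_blinfun S(1)) (subst smooth_on_cong[OF S(1)], auto)
  define A' where "A' x = Blinfun (frechet_derivative A (at x))" for x
  have A': "A' x u = frechet_derivative A (at x) u" if "x \<in> S" for x u
    using smooth_on_has_derivative[OF smA that]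
    by (simp add: A'_def bounded_linear_Blinfun_apply has_derivative_bounded_linear)
  have derA: "(A has_derivative blinfun_apply (A' x)) (at x)" if "x \<in> S" for x
    using smooth_on_has_derivative[OF smA that] by (simp add: ext[OF A'[OF that]])
  have contA': "continuous_on S A'"
    by (rule continuous_on_blinfun_componentwise)
      (simp add: A' smooth_on_imp_continuous_on[OF smooth_on_frechet_derivative[OF smA]] cong: continuous_on_cong)
  have D: "frechet_derivative (\<lambda>x. a x v z) (at x) u = A' x u v z" if "x \<in> S" for x u v z
  proof -
    have "((\<lambda>x. A x v z) has_derivative (\<lambda>u. A' x u v z)) (at x)"
      by (rule has_derivative_eq_rhs[OF blinfun.FDERIV[OF blinfun.FDERIV[OF derA[OF that] has_derivative_const] has_derivative_const]])
        (simp add: fun_eq_iff)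
    then have "((\<lambda>x. a x v z) has_derivative (\<lambda>u. A' x u v z)) (at x)"
      by (rule has_derivative_transform_within_open[OF _ S(1) that]) (simp add: A)
    then show ?thesis by (metis frechet_derivative_at)
  qed
  have flatA: "A' x u v z + A x v (A x u z) = A' x v u z + A x u (A x v z)" if "x \<in> S" for x u v z
    using flat[OF that, of v z u] by (simp add: D that A)
  obtain r where r: "r > 0" "ball x0 r \<subseteq> S"
    and Y: "\<And>y0. \<exists>Y. Y x0 = y0 \<and> (\<forall>x\<in>ball x0 r. (Y has_derivative (\<lambda>u. A x u (Y x))) (at x))"
    using flat_linear_system_solution[OF S derA contA' flatA] by blast
  have smY: "smooth_on (ball x0 r) Y"
    if "\<And>x. x \<in> ball x0 r \<Longrightarrow> (Y has_derivative (\<lambda>u. a x u (Y x))) (at x)" for Y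
  proof (rule smooth_on_bootstrap[OF open_ball that])
    fix k v assume "Ck_on k (ball x0 r) Y"
    moreover have "Ck_on k (ball x0 r) (\<lambda>x. a x v z)" for z
      using smooth[of v z] r Ck_on_subset unfolding smooth_on_def by blast
    \<comment> \<open>In this expansion the coefficients \<open>a x v j\<close> have fixed arguments
      and are smooth, so the right-hand side inherits the order of \<open>Y\<close>.\<close>
    ultimately have "Ck_on k (ball x0 r) (\<lambda>x. \<Sum>j\<in>Basis. (Y x \<bullet> j) *\<^sub>R a x v j)"
      by (intro Ck_on_sum Ck_on_bounded_bilinear[OF bounded_bilinear_scaleR]
          Ck_on_bounded_linear[OF bounded_linear_inner_left]) auto
    moreover have "(\<Sum>j\<in>Basis. (Y x \<bullet> j) *\<^sub>R a x v j) = a x v (Y x)" if "x \<in> ball x0 r" for x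
    proof -
      have "linear (a x v)" using bil that r by (auto simp: bilinear_def)
      then show ?thesis
        by (subst (2) euclidean_representation[of "Y x", symmetric]) (simp add: linear_sum linear_scale)
    qed
    ultimately show "Ck_on k (ball x0 r) (\<lambda>x. a x v (Y x))"
      using Ck_on_cong[OF open_ball, of x0 r "\<lambda>x. \<Sum>j\<in>Basis. (Y x \<bullet> j) *\<^sub>R a x v j" "\<lambda>x. a x v (Y x)" k]
      by simp
  qed auto
  have exY: "\<exists>Y. Y x0 = y0 \<and> (\<forall>x\<in>ball x0 r. (Y has_derivative (\<lambda>u. a x u (Y x))) (at x))" for y0
  proof -
    obtain Y where "Y x0 = y0" "\<And>x. x \<in> ball x0 r \<Longrightarrow> (Y has_derivative (\<lambda>u. A x u (Y x))) (at x)"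
      using Y by blast
    moreover have "(\<lambda>u. A x u (Y x)) = (\<lambda>u. a x u (Y x))" if "x \<in> ball x0 r" for x
      using A that r(2) by auto
    ultimately show ?thesis by metis
  qed
  show thesis
  proof (rule that[OF r], rule allI)
    fix y0
    from exY[of y0] obtain Y where Y: "Y x0 = y0"
      "\<And>x. x \<in> ball x0 r \<Longrightarrow> (Y has_derivative (\<lambda>u. a x u (Y x))) (at x)" by blast
    then show "\<exists>Y. Y x0 = y0 \<and> smooth_on (ball x0 r) Y \<and>
      (\<forall>x\<in>ball x0 r. (Y has_derivative (\<lambda>u. a x u (Y x))) (at x))"
      using smY[OF Y(2)] by (intro exI[of _ Y]) simp
  qed
qed

subsection \<open>Flat coordinates\<close>

lemma smooth_on_Pair:
  assumes "open S" "smooth_on S f" "smooth_on S g"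
  shows "smooth_on S (\<lambda>x. (f x, g x))"
proof -
  have "smooth_on S (\<lambda>x. (f x, 0) + (0, g x))"
    using assms
    by (intro smooth_on_add smooth_on_bounded_linear[where L = "\<lambda>z. (z, 0)"]
        smooth_on_bounded_linear[where L = "\<lambda>z. (0, z)"] bounded_linear_Pair
        bounded_linear_ident bounded_linear_zero)
  then show ?thesis by simp
qed

text \<open>The functions \<open>f\<close> with parallel differential \<open>\<beta>\<close> solve the linear system
  \<open>D\<^sub>u \<beta> = \<beta> \<circ> \<Gamma>(u, -)\<close>, \<open>D\<^sub>u f = \<beta>(u)\<close>, which is flat because the curvature and the torsion vanish.
  The parallel frame inverts the Jacobian, so the inverse of the coordinate map is smooth by
  bootstrapping.\<close>
lemma flat_coordinates:
  fixes \<Gamma> :: "'a::euclidean_space \<Rightarrow> 'a \<Rightarrow> 'a \<Rightarrow> 'a"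
  assumes S: "open S" "x0 \<in> S"
    and bil: "\<And>x. x \<in> S \<Longrightarrow> bilinear (\<Gamma> x)"
    and smooth: "\<And>u v. smooth_on S (\<lambda>x. \<Gamma> x u v)"
    and sym: "\<And>x u v. x \<in> S \<Longrightarrow> \<Gamma> x u v = \<Gamma> x v u"
    and curv: "\<And>x u v w. x \<in> S \<Longrightarrow>
      frechet_derivative (\<lambda>x. \<Gamma> x v w) (at x) u - frechet_derivative (\<lambda>x. \<Gamma> x u w) (at x) v
      + \<Gamma> x u (\<Gamma> x v w) - \<Gamma> x v (\<Gamma> x u w) = 0"
  obtains U and \<phi> \<eta> :: "'a \<Rightarrow> 'a" where "open U" "x0 \<in> U" "U \<subseteq> S" "open (\<phi> ` U)" "smooth_on U \<phi>" "smooth_on (\<phi> ` U) \<eta>"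
    "\<And>x. x \<in> U \<Longrightarrow> \<eta> (\<phi> x) = x"
    "\<And>x. x \<in> U \<Longrightarrow> surj (frechet_derivative \<phi> (at x))"
    "\<And>x u v. x \<in> U \<Longrightarrow> second_derivative \<phi> x u v = frechet_derivative \<phi> (at x) (\<Gamma> x u v)"
proof -
  have lin1: "linear (\<lambda>u. \<Gamma> x u v)" and lin2: "linear (\<Gamma> x u)" if "x \<in> S" for x u v
    using bil[OF that] by (auto simp: bilinear_def)
  have der\<Gamma>: "((\<lambda>x. \<Gamma> x u v) has_derivative frechet_derivative (\<lambda>x. \<Gamma> x u v) (at x)) (at x)"
    if "x \<in> S" for x u v
    by (rule smooth_on_has_derivative[OF smooth that])
  \<comment> \<open>Covectors are represented by vectors through the inner product;
    \<open>T x u\<close> is then the adjoint of \<open>\<Gamma> x u\<close>.\<close>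
  define T where "T x u \<beta> = (\<Sum>j\<in>Basis. (\<beta> \<bullet> \<Gamma> x u j) *\<^sub>R j)" for x u and \<beta> :: 'a
  have T: "T x u \<beta> \<bullet> w = \<beta> \<bullet> \<Gamma> x u w" if "x \<in> S" for x u \<beta> w
  proof -
    have "\<Gamma> x u w = \<Gamma> x u (\<Sum>j\<in>Basis. (w \<bullet> j) *\<^sub>R j)" by (simp add: euclidean_representation)
    also have "\<dots> = (\<Sum>j\<in>Basis. (w \<bullet> j) *\<^sub>R \<Gamma> x u j)"
      using lin2[OF that] by (simp add: linear_sum linear_scale)
    finally show ?thesis
      by (simp add: T_def inner_sum_left inner_sum_right mult.commute inner_commute)
  qed
  \<comment> \<open>The state of the system is a covector together with the value of its
    primitive.\<close>
  define a where "a x u y = (T x u (fst y), fst y \<bullet> u)" for x u and y :: "'a \<times> real"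
  have bila: "bilinear (a x)" if "x \<in> S" for x
  proof -
    have "T x (u + v) \<beta> = T x u \<beta> + T x v \<beta>" "T x (c *\<^sub>R u) \<beta> = c *\<^sub>R T x u \<beta>" for u v \<beta> c
      using linear_add[OF lin1[OF that]] linear_scale[OF lin1[OF that]]
      by (auto simp: T_def inner_add_right scaleR_left_distrib sum.distrib scaleR_sum_right)
    moreover have "T x u (\<beta> + \<gamma>) = T x u \<beta> + T x u \<gamma>" "T x u (c *\<^sub>R \<beta>) = c *\<^sub>R T x u \<beta>" for u \<gamma> \<beta> c
      by (auto simp: T_def inner_add_left scaleR_left_distrib sum.distrib scaleR_sum_right)
    ultimately show ?thesis
      by (auto simp: bilinear_def a_def intro!: linearI simp: inner_add_left inner_add_right)
  qed
  have smootha: "smooth_on S (\<lambda>x. a x u y)" for u y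
    unfolding a_def T_def
    using smooth
    by (intro smooth_on_Pair smooth_on_sum smooth_on_const S
        smooth_on_bounded_linear[where L = "\<lambda>z. z *\<^sub>R _"] bounded_linear_scaleR_left
        smooth_on_bounded_linear[where L = "\<lambda>z. _ \<bullet> z"] bounded_linear_inner_right)
  have Da: "frechet_derivative (\<lambda>x. a x v y) (at x) u =
      (\<Sum>j\<in>Basis. (fst y \<bullet> frechet_derivative (\<lambda>x. \<Gamma> x v j) (at x) u) *\<^sub>R j, 0)" if "x \<in> S" for x u v y
  proof -
    have "((\<lambda>x. a x v y) has_derivative
      (\<lambda>u. (\<Sum>j\<in>Basis. (fst y \<bullet> frechet_derivative (\<lambda>x. \<Gamma> x v j) (at x) u) *\<^sub>R j, 0))) (at x)"
      unfolding a_def T_def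
      by (intro has_derivative_Pair has_derivative_sum has_derivative_const
          bounded_linear.has_derivative[OF bounded_linear_scaleR_left]
          bounded_linear.has_derivative[OF bounded_linear_inner_right] der\<Gamma>[OF that])
    from frechet_derivative_at[OF this, symmetric] show ?thesis by simp
  qed
  have flata: "frechet_derivative (\<lambda>x. a x v y) (at x) u + a x v (a x u y) =
      frechet_derivative (\<lambda>x. a x u y) (at x) v + a x u (a x v y)" if x: "x \<in> S" for x u v y
  proof -
    \<comment> \<open>Vanishing curvature settles the covector component. In the primitive component
      the condition is the symmetry of \<open>\<Gamma>\<close>, that is, vanishing torsion.\<close>
    have "frechet_derivative (\<lambda>x. \<Gamma> x v j) (at x) u + \<Gamma> x u (\<Gamma> x v j) =
      frechet_derivative (\<lambda>x. \<Gamma> x u j) (at x) v + \<Gamma> x v (\<Gamma> x u j)" for j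
      using curv[OF x, of v j u] by (simp add: algebra_simps)
    then have "fst y \<bullet> frechet_derivative (\<lambda>x. \<Gamma> x v j) (at x) u + fst y \<bullet> \<Gamma> x u (\<Gamma> x v j) =
      fst y \<bullet> frechet_derivative (\<lambda>x. \<Gamma> x u j) (at x) v + fst y \<bullet> \<Gamma> x v (\<Gamma> x u j)" for j
      by (metis inner_add_right)
    moreover have "T x v (T x u (fst y)) = (\<Sum>j\<in>Basis. (fst y \<bullet> \<Gamma> x u (\<Gamma> x v j)) *\<^sub>R j)" for u v
      by (simp only: T_def[of x v] T[OF x])
    ultimately show ?thesis
      unfolding Da[OF x] by (simp add: a_def T[OF x] sym[OF x, of u v] sum.distrib[symmetric] scaleR_left_distrib[symmetric])
  qed
  \<comment> \<open>The second system describes parallel vector fields; its integrability condition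
    is again the vanishing of the curvature.\<close>
  have bilb: "bilinear (\<lambda>u z. - \<Gamma> x u z)" if "x \<in> S" for x
    using lin1[OF that] lin2[OF that] by (auto simp: bilinear_def intro: linear_compose_neg)
  have smoothb: "smooth_on S (\<lambda>x. - \<Gamma> x u z)" for u z
    by (rule smooth_on_minus[OF S(1) smooth])
  have Db: "frechet_derivative (\<lambda>x. - \<Gamma> x v z) (at x) u = - frechet_derivative (\<lambda>x. \<Gamma> x v z) (at x) u"
    if "x \<in> S" for x u v z
    using frechet_derivative_at[OF has_derivative_minus[OF der\<Gamma>[OF that]], symmetric] by simp
  have flatb: "frechet_derivative (\<lambda>x. - \<Gamma> x v z) (at x) u + - \<Gamma> x v (- \<Gamma> x u z) =
      frechet_derivative (\<lambda>x. - \<Gamma> x u z) (at x) v + - \<Gamma> x u (- \<Gamma> x v z)" if x: "x \<in> S" for x u v z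
    using curv[OF x, of v z u] linear_neg[OF lin2[OF x]] by (simp add: Db[OF x] algebra_simps)
  obtain r1 where r1: "r1 > 0" "ball x0 r1 \<subseteq> S"
    and Y: "\<forall>y0. \<exists>Y. Y x0 = y0 \<and> smooth_on (ball x0 r1) Y \<and>
      (\<forall>x\<in>ball x0 r1. (Y has_derivative (\<lambda>u. a x u (Y x))) (at x))"
    by (rule flat_linear_system_smooth_solution[OF S bila smootha flata])
  obtain r2 where r2: "r2 > 0" "ball x0 r2 \<subseteq> S"
    and F: "\<forall>y0. \<exists>F. F x0 = y0 \<and> smooth_on (ball x0 r2) F \<and>
      (\<forall>x\<in>ball x0 r2. (F has_derivative (\<lambda>u. - \<Gamma> x u (F x))) (at x))"
    by (rule flat_linear_system_smooth_solution[OF S bilb smoothb flatb])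
  define B where "B = ball x0 (min r1 r2)"
  have B: "open B" "x0 \<in> B" "B \<subseteq> S" "convex B" "B \<subseteq> ball x0 r1" "B \<subseteq> ball x0 r2"
    using r1 r2 by (auto simp: B_def)
  from choice[OF Y] obtain Y' where Y': "\<forall>z. Y' z x0 = z \<and> smooth_on (ball x0 r1) (Y' z) \<and>
      (\<forall>x\<in>ball x0 r1. (Y' z has_derivative (\<lambda>u. a x u (Y' z x))) (at x))" by (rule exE)
  define Y where "Y i = Y' (i, 0)" for i
  have Y: "Y i x0 = (i, 0)" "smooth_on (ball x0 r1) (Y i)"
    "x \<in> ball x0 r1 \<Longrightarrow> (Y i has_derivative (\<lambda>u. a x u (Y i x))) (at x)" for i x
    using Y'[rule_format, of "(i, 0)"] by (simp_all only: Y_def)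
  from choice[OF F] obtain F where F': "\<forall>z. F z x0 = z \<and> smooth_on (ball x0 r2) (F z) \<and>
      (\<forall>x\<in>ball x0 r2. (F z has_derivative (\<lambda>u. - \<Gamma> x u (F z x))) (at x))" by (rule exE)
  have F: "F i x0 = i" "smooth_on (ball x0 r2) (F i)"
    "x \<in> ball x0 r2 \<Longrightarrow> (F i has_derivative (\<lambda>u. - \<Gamma> x u (F i x))) (at x)" for i x
    using F'[rule_format, of i] by simp_all
  define \<beta> where "\<beta> i x = fst (Y i x)" for i x
  have \<beta>: "(\<beta> i has_derivative (\<lambda>u. T x u (\<beta> i x))) (at x)"
    and f: "((\<lambda>x. snd (Y i x)) has_derivative (\<lambda>u. \<beta> i x \<bullet> u)) (at x)" if "x \<in> B" for i x
    using has_derivative_fst[OF Y(3)[of x i]] has_derivative_snd[OF Y(3)[of x i]] that B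
    by (auto simp: a_def \<beta>_def[abs_def])
  have sm\<beta>: "smooth_on B (\<beta> i)" and smf: "smooth_on B (\<lambda>x. snd (Y i x))" and smF: "smooth_on B (F i)" for i
    using Y(2)[of i] F(2)[of i] B smooth_on_subset unfolding \<beta>_def[abs_def]
    by (blast intro: smooth_on_bounded_linear bounded_linear_fst bounded_linear_snd)+
  \<comment> \<open>The two systems are adjoint up to sign, so the pairing of a parallel covector
    field with a parallel vector field is constant on the convex set \<open>B\<close>; its value is
    read off at \<open>x0\<close>.\<close>
  have dual: "\<beta> i x \<bullet> F j x = i \<bullet> j" if x: "x \<in> B" for i j x
  proof -
    have "((\<lambda>x. \<beta> i x \<bullet> F j x) has_derivative (\<lambda>u. 0)) (at x within B)" if x: "x \<in> B" for x
    proof -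
      have "((\<lambda>x. \<beta> i x \<bullet> F j x) has_derivative (\<lambda>u. \<beta> i x \<bullet> - \<Gamma> x u (F j x) + T x u (\<beta> i x) \<bullet> F j x)) (at x)"
        using x B by (intro has_derivative_inner \<beta> F) auto
      moreover have "x \<in> S" using x B(3) by blast
      ultimately show ?thesis
        by (simp add: T has_derivative_at_withinI)
    qed
    from has_derivative_zero_unique[OF B(4) this x B(2)] show ?thesis by (simp add: F(1) Y(1) \<beta>_def)
  qed
  define \<phi> where "\<phi> x = (\<Sum>i\<in>Basis. snd (Y i x) *\<^sub>R i)" for x
  \<comment> \<open>\<open>P x\<close> is the Jacobian of \<open>\<phi>\<close>, assembled from the
    parallel covectors; \<open>Q x\<close> is its inverse, assembled from the parallel
    frame.\<close>
  define P where "P x u = (\<Sum>i\<in>Basis. (\<beta> i x \<bullet> u) *\<^sub>R i)" for x u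
  define Q where "Q x w = (\<Sum>j\<in>Basis. (w \<bullet> j) *\<^sub>R F j x)" for x w
  have d\<phi>: "(\<phi> has_derivative P x) (at x)" if "x \<in> B" for x
    unfolding \<phi>_def[abs_def] P_def[abs_def]
    by (intro has_derivative_sum bounded_linear.has_derivative[OF bounded_linear_scaleR_left] f that)
  have sm\<phi>: "smooth_on B \<phi>"
    unfolding \<phi>_def[abs_def]
    by (intro smooth_on_sum smooth_on_bounded_linear[OF bounded_linear_scaleR_left] smf B)
  have frP: "frechet_derivative \<phi> (at x) = P x" if "x \<in> B" for x
    by (rule frechet_derivative_at[OF d\<phi>[OF that], symmetric])
  have blP: "bounded_linear (P x)" and blQ: "bounded_linear (Q x)" for x
    unfolding P_def[abs_def] Q_def[abs_def] by (intro bounded_linear_intros)+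
  have PQ: "P x (Q x w) = w" if "x \<in> B" for x w
  proof -
    have "\<beta> i x \<bullet> Q x w = w \<bullet> i" if i: "i \<in> Basis" for i
    proof -
      have "\<beta> i x \<bullet> Q x w = (\<Sum>j\<in>Basis. (w \<bullet> j) * (i \<bullet> j))"
        by (simp add: Q_def inner_sum_right dual[OF \<open>x \<in> B\<close>])
      also have "\<dots> = w \<bullet> i" using i by (simp add: euclidean_inner[of w i])
      finally show ?thesis .
    qed
    then show ?thesis by (simp add: P_def euclidean_representation)
  qed
  have QP: "Q x (P x w) = w" if "x \<in> B" for x w
  proof -
    have "P x \<circ> Q x = id" using PQ[OF that] by auto
    then have "Q x \<circ> P x = id"
      using linear_inverse_left[of "P x" "Q x"] blP blQ bounded_linear.linear by blast
    then show ?thesis by (metis comp_apply id_apply)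
  qed
  have c1: "continuous_on B (\<lambda>x. Blinfun (P x))"
    by (rule continuous_on_blinfun_componentwise)
      (auto simp: bounded_linear_Blinfun_apply blP P_def
        intro!: continuous_intros smooth_on_imp_continuous_on[OF sm\<beta>])
  \<comment> \<open>The initial values are the basis vectors, so the Jacobian at \<open>x0\<close>
    is the identity and is its own inverse.\<close>
  have c2: "id_blinfun o\<^sub>L Blinfun (P x0) = id_blinfun"
    by (rule blinfun_eqI)
      (simp add: bounded_linear_Blinfun_apply blP P_def \<beta>_def Y(1) inner_commute euclidean_representation)
  have d\<phi>': "(\<phi> has_derivative blinfun_apply (Blinfun (P x))) (at x)" if "x \<in> B" for x
    using d\<phi>[OF that] by (simp add: bounded_linear_Blinfun_apply blP)
  obtain U V \<eta> where U: "open U" "U \<subseteq> B" "x0 \<in> U" "open V" "homeomorphism U V \<phi> \<eta>"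
    and \<eta>: "\<forall>y\<in>V. (\<eta> has_derivative inv (P (\<eta> y))) (at y)"
  proof (rule inverse_function_theorem[OF B(1) d\<phi>' c1 B(2) c2])
    fix U V g g'
    assume h: "open U" "U \<subseteq> B" "x0 \<in> U" "open V" "homeomorphism U V \<phi> g"
      and g: "\<And>y. y \<in> V \<Longrightarrow> (g has_derivative g' y) (at y)"
        "\<And>y. y \<in> V \<Longrightarrow> g' y = inv (blinfun_apply (Blinfun (P (g y))))"
    have "\<forall>y\<in>V. (g has_derivative inv (P (g y))) (at y)"
    proof
      fix y assume "y \<in> V"
      from g[OF this] show "(g has_derivative inv (P (g y))) (at y)"
        by (simp add: bounded_linear_Blinfun_apply blP)
    qed
    then show thesis by (rule that[OF h])
  qed
  have UV: "\<phi> ` U = V" "\<And>x. x \<in> U \<Longrightarrow> \<eta> (\<phi> x) = x" "\<And>y. y \<in> V \<Longrightarrow> \<eta> y \<in> U"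
    using U(5) by (auto simp: homeomorphism_def)
  have \<eta>Q: "(\<eta> has_derivative Q (\<eta> y)) (at y)" if y: "y \<in> V" for y
  proof -
    have "\<eta> y \<in> B" using UV(3)[OF y] U(2) by blast
    then have "inv (P (\<eta> y)) = Q (\<eta> y)" using PQ QP by (intro inv_equality) auto
    then show ?thesis using \<eta> y by auto
  qed
  have "smooth_on V \<eta>"
  proof (rule smooth_on_bootstrap[OF U(4) \<eta>Q])
    fix k w assume \<eta>k: "Ck_on k V \<eta>"
    have "Ck_on k V (\<lambda>y. F j (\<eta> y))" for j
      using smF[of j] UV(3) U(2) unfolding smooth_on_def
      by (intro Ck_on_compose[OF U(4) B(1) _ _ \<eta>k]) auto
    then show "Ck_on k V (\<lambda>y. Q (\<eta> y) w)"
      unfolding Q_def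
      by (intro Ck_on_sum Ck_on_bounded_linear[OF bounded_linear_scaleR_right] U)
  qed
  moreover have "second_derivative \<phi> x u v = frechet_derivative \<phi> (at x) (\<Gamma> x u v)" if x: "x \<in> U" for x u v
  proof -
    have xB: "x \<in> B" using x U by blast
    have "((\<lambda>y. P y v) has_derivative (\<lambda>u. \<Sum>i\<in>Basis. (T x u (\<beta> i x) \<bullet> v) *\<^sub>R i)) (at x)"
      unfolding P_def
      by (intro has_derivative_sum bounded_linear.has_derivative[OF bounded_linear_scaleR_left]
          bounded_linear.has_derivative[OF bounded_linear_inner_left] \<beta> xB)
    then have "((\<lambda>y. P y v) has_derivative (\<lambda>u. P x (\<Gamma> x u v))) (at x)"
      using xB B(3) by (simp add: T subsetD P_def)
    then have "((\<lambda>y. frechet_derivative \<phi> (at y) v) has_derivative (\<lambda>u. P x (\<Gamma> x u v))) (at x)"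
      by (rule has_derivative_transform_within_open[OF _ B(1) xB]) (simp add: frP)
    from frechet_derivative_at[OF this, symmetric] show ?thesis
      by (simp add: second_derivative_def frP[OF xB])
  qed
  moreover have "surj (frechet_derivative \<phi> (at x))" if "x \<in> U" for x
    using that U(2) PQ frP by (metis subsetD surjI)
  ultimately show thesis
    using U(1-3) B(3) UV(1,2) U(4) smooth_on_subset[OF sm\<phi> U(2)]
    by (intro that[of U \<phi> \<eta>]) auto
qed

subsection \<open>Charts\<close>

lemma frechet_derivative_cong_open:
  assumes "open S" "x \<in> S" "\<And>y. y \<in> S \<Longrightarrow> f y = g y"
  shows "frechet_derivative f (at x) = frechet_derivative g (at x)"
proof -
  have "(f has_derivative d) (at x) \<longleftrightarrow> (g has_derivative d) (at x)" for d
    using has_derivative_transform_within_open[OF _ assms(1,2)] assms(3) by metis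
  then show ?thesis by (simp add: frechet_derivative_def)
qed

lemma second_derivative_cong_open:
  assumes "open S" "x \<in> S" "\<And>y. y \<in> S \<Longrightarrow> f y = g y"
  shows "second_derivative f x u v = second_derivative g x u v"
  unfolding second_derivative_def
  by (rule fun_cong[OF frechet_derivative_cong_open[OF assms(1,2)]])
    (rule fun_cong[OF frechet_derivative_cong_open[OF assms(1) _ assms(3)]])

context
  fixes M :: "'m topology" and A :: "('m, 'n::finite) chart set"
  assumes M: "smooth_manifold M A"
begin

lemma chartD:
  assumes "c \<in> A"
  shows "openin M (chart_dom c)" "open (coord c ` chart_dom c)" "chart_dom c \<subseteq> topspace M"
    "homeomorphic_map (subtopology M (chart_dom c)) (top_of_set (coord c ` chart_dom c)) (coord c)"
    "topspace (subtopology M (chart_dom c)) = chart_dom c"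
proof -
  have c: "is_chart M c" using M assms by (auto simp: smooth_manifold_def)
  then show "openin M (chart_dom c)" "open (coord c ` chart_dom c)"
    "homeomorphic_map (subtopology M (chart_dom c)) (top_of_set (coord c ` chart_dom c)) (coord c)"
    by (auto simp: is_chart_def)
  then show "chart_dom c \<subseteq> topspace M" "topspace (subtopology M (chart_dom c)) = chart_dom c"
    using openin_subset by (auto simp: topspace_subtopology)
qed

lemma chart_inj: "c \<in> A \<Longrightarrow> inj_on (coord c) (chart_dom c)"
  using homeomorphic_imp_injective_map[OF chartD(4)] chartD(5) by metis

lemma inv_coord_coord: "c \<in> A \<Longrightarrow> p \<in> chart_dom c \<Longrightarrow> inv_coord c (coord c p) = p"
  unfolding inv_coord_def by (rule inv_into_f_f[OF chart_inj])

lemma coord_inv_coord: "x \<in> coord c ` chart_dom c \<Longrightarrow> coord c (inv_coord c x) = x"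
  unfolding inv_coord_def by (rule f_inv_into_f)

lemma inv_coord_in: "x \<in> coord c ` chart_dom c \<Longrightarrow> inv_coord c x \<in> chart_dom c"
  unfolding inv_coord_def by (rule inv_into_into)

lemma chart_exists: "p \<in> topspace M \<Longrightarrow> \<exists>c\<in>A. p \<in> chart_dom c"
  using M unfolding smooth_manifold_def by blast

lemma homeomorphic_maps_chart:
  assumes "c \<in> A"
  shows "homeomorphic_maps (subtopology M (chart_dom c)) (top_of_set (coord c ` chart_dom c)) (coord c) (inv_coord c)"
proof -
  obtain g where g: "homeomorphic_maps (subtopology M (chart_dom c)) (top_of_set (coord c ` chart_dom c)) (coord c) g"
    using chartD(4)[OF assms] homeomorphic_map_maps by blast
  moreover have "g x = inv_coord c x" if "x \<in> coord c ` chart_dom c" for x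
    using that g chartD(5)[OF assms] inv_coord_coord[OF assms] by (auto simp: homeomorphic_maps_def)
  ultimately show ?thesis
    using homeomorphic_maps_eq by fastforce
qed

lemma open_coord_image:
  assumes "c \<in> A" "openin M V"
  shows "open (coord c ` (chart_dom c \<inter> V))"
proof -
  have "openin (subtopology M (chart_dom c)) (chart_dom c \<inter> V)"
    by (rule openin_subtopology_Int2[OF assms(2)])
  then have "openin (top_of_set (coord c ` chart_dom c)) (coord c ` (chart_dom c \<inter> V))"
    by (subst homeomorphic_map_openness[OF chartD(4)[OF assms(1)]])
      (simp_all only: chartD(5)[OF assms(1)] Int_lower1)
  then show ?thesis
    by (rule openin_open_trans[OF _ chartD(2)[OF assms(1)]])
qed

lemma openin_coord_vimage:
  assumes "c \<in> A" "open W"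
  shows "openin M {p \<in> chart_dom c. coord c p \<in> W}"
proof -
  have "openin (subtopology M (chart_dom c)) {p \<in> topspace (subtopology M (chart_dom c)). coord c p \<in> W \<inter> coord c ` chart_dom c}"
    by (rule openin_continuous_map_preimage[OF homeomorphic_imp_continuous_map[OF chartD(4)[OF assms(1)]]])
      (use assms in \<open>auto simp: openin_open\<close>)
  moreover have "{p \<in> topspace (subtopology M (chart_dom c)). coord c p \<in> W \<inter> coord c ` chart_dom c} =
      {p \<in> chart_dom c. coord c p \<in> W}"
    unfolding chartD(5)[OF assms(1)] by auto
  ultimately show ?thesis
    using openin_trans_full[OF _ chartD(1)[OF assms(1)]] by simp
qed

lemma transition_smooth:
  assumes "c \<in> A" "c' \<in> A"
  shows "smooth_on (coord c ` (chart_dom c \<inter> chart_dom c')) (transition c c')"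
  using M assms by (auto simp: smooth_manifold_def compatible_def)

lemma open_overlap: "c \<in> A \<Longrightarrow> c' \<in> A \<Longrightarrow> open (coord c ` (chart_dom c \<inter> chart_dom c'))"
  by (intro open_coord_image chartD)

lemma transition_coord: "c \<in> A \<Longrightarrow> p \<in> chart_dom c \<Longrightarrow> transition c c' (coord c p) = coord c' p"
  by (simp add: transition_def inv_coord_coord)

lemma transition_derivative:
  assumes "c \<in> A" "c' \<in> A" "p \<in> chart_dom c" "p \<in> chart_dom c'"
  shows "(transition c c' has_derivative change_vec c c' p) (at (coord c p))"
proof -
  have "coord c p \<in> coord c ` (chart_dom c \<inter> chart_dom c')" using assms by auto
  from smooth_on_has_derivative[OF transition_smooth[OF assms(1,2)] this]
  show ?thesis unfolding change_vec_def[abs_def] .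
qed

lemma linear_change_vec:
  assumes "c \<in> A" "c' \<in> A" "p \<in> chart_dom c" "p \<in> chart_dom c'"
  shows "linear (change_vec c c' p)"
  using has_derivative_linear[OF transition_derivative[OF assms]] .

section \<open>New charts in the maximal atlas, and affine charts\<close>

text \<open>Maximality of the atlas reduces membership to compatibility with every chart
  \<open>c''\<close>. The transitions of the new chart are those of \<open>c\<close> preceded by
  \<open>\<eta>\<close> or followed by \<open>\<phi>\<close>, hence smooth.\<close>

lemma reparametrized_chart:
  assumes c: "c \<in> A" and U: "open U" "U \<subseteq> coord c ` chart_dom c" "open (\<phi> ` U)"
    and sm: "smooth_on U \<phi>" "smooth_on (\<phi> ` U) \<eta>" and \<eta>: "\<And>x. x \<in> U \<Longrightarrow> \<eta> (\<phi> x) = x"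
  shows "(inv_coord c ` U, \<phi> \<circ> coord c) \<in> A"
proof -
  define V where "V = inv_coord c ` U"
  define c' where "c' = (V, \<phi> \<circ> coord c)"
  have V: "V = {p \<in> chart_dom c. coord c p \<in> U}"
    using U(2) coord_inv_coord inv_coord_in inv_coord_coord[OF c] unfolding V_def by (force simp: image_iff)
  have VU: "coord c ` V = U"
    using U(2) unfolding V by auto
  have imV: "(\<phi> \<circ> coord c) ` V = \<phi> ` U"
    unfolding image_comp[symmetric] VU ..
  have oV: "openin M V" unfolding V by (rule openin_coord_vimage[OF c U(1)])
  have Vsub: "V \<subseteq> chart_dom c" unfolding V by auto
  have topV: "topspace (subtopology M V) = V" using openin_subset[OF oV] by (auto simp: topspace_subtopology)
  have "homeomorphic_maps (subtopology M V) (top_of_set (\<phi> ` U)) (\<phi> \<circ> coord c) (inv_coord c \<circ> \<eta>)"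
    unfolding homeomorphic_maps_def
  proof (intro conjI ballI)
    have "continuous_map (subtopology M (chart_dom c)) (top_of_set (coord c ` chart_dom c)) (coord c)"
      using homeomorphic_maps_chart[OF c] by (simp add: homeomorphic_maps_def)
    then have "continuous_map (subtopology M V) (top_of_set U) (coord c)"
      using VU continuous_map_from_subtopology_mono[OF _ Vsub]
      by (fastforce simp: continuous_map_in_subtopology)
    moreover have "continuous_map (top_of_set U) (top_of_set (\<phi> ` U)) \<phi>"
      using smooth_on_imp_continuous_on[OF sm(1)] by auto
    ultimately show "continuous_map (subtopology M V) (top_of_set (\<phi> ` U)) (\<phi> \<circ> coord c)"
      by (rule continuous_map_compose)
    have "continuous_map (top_of_set (\<phi> ` U)) (top_of_set (coord c ` chart_dom c)) \<eta>"
      using smooth_on_imp_continuous_on[OF sm(2)] U(2) \<eta> by auto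
    moreover have "continuous_map (top_of_set (coord c ` chart_dom c)) (subtopology M (chart_dom c)) (inv_coord c)"
      using homeomorphic_maps_chart[OF c] by (simp add: homeomorphic_maps_def)
    ultimately have "continuous_map (top_of_set (\<phi> ` U)) (subtopology M (chart_dom c)) (inv_coord c \<circ> \<eta>)"
      by (rule continuous_map_compose)
    moreover have "(inv_coord c \<circ> \<eta>) ` (\<phi> ` U) \<subseteq> V" using \<eta> by (auto simp: V_def)
    ultimately show "continuous_map (top_of_set (\<phi> ` U)) (subtopology M V) (inv_coord c \<circ> \<eta>)"
      by (auto simp: continuous_map_in_subtopology)
    show "(inv_coord c \<circ> \<eta>) ((\<phi> \<circ> coord c) p) = p" if "p \<in> topspace (subtopology M V)" for p
      using that unfolding topV by (auto simp: V \<eta> inv_coord_coord[OF c])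
    show "(\<phi> \<circ> coord c) ((inv_coord c \<circ> \<eta>) y) = y" if "y \<in> topspace (top_of_set (\<phi> ` U))" for y
      using that U(2) by (auto simp: \<eta> coord_inv_coord subset_iff)
  qed
  then have hom: "homeomorphic_map (subtopology M V) (top_of_set (\<phi> ` U)) (\<phi> \<circ> coord c)"
    by (auto simp: homeomorphic_map_maps)
  then have chart: "is_chart M c'"
    using oV U(3) unfolding is_chart_def c'_def fst_conv snd_conv imV by blast
  have invc': "inv_coord c' (\<phi> x) = inv_coord c x" if "x \<in> U" for x
  proof -
    have e: "inv_coord c' = inv_into V (\<phi> \<circ> coord c)" by (simp add: inv_coord_def c'_def)
    have i: "inj_on (\<phi> \<circ> coord c) V"
      by (rule comp_inj_on[OF inj_on_subset[OF chart_inj[OF c] Vsub]])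
        (use VU \<eta> in \<open>auto intro: inj_on_inverseI\<close>)
    have "inv_coord c x \<in> V" using that by (auto simp: V_def)
    from inv_into_f_f[OF i this] show ?thesis
      using that U(2) by (simp add: e coord_inv_coord subset_iff)
  qed
  have "compatible c' c''" if c'': "c'' \<in> A" for c''
    unfolding compatible_def
  proof
    let ?O = "coord c ` (V \<inter> chart_dom c'')"
    have O: "?O \<subseteq> U" "?O \<subseteq> coord c ` (chart_dom c \<inter> chart_dom c'')"
      using VU Vsub by auto
    have im: "coord c' ` (chart_dom c' \<inter> chart_dom c'') = \<phi> ` ?O"
      by (simp add: c'_def image_comp)
    have "openin (subtopology M V) (V \<inter> chart_dom c'')"
      by (rule openin_subtopology_Int2[OF chartD(1)[OF c'']])
    then have "openin (top_of_set (\<phi> ` U)) (\<phi> ` ?O)"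
      unfolding image_comp
      by (subst homeomorphic_map_openness[OF hom]) (simp_all only: topV Int_lower1)
    then have op: "open (\<phi> ` ?O)" by (rule openin_open_trans[OF _ U(3)])
    have "smooth_on (\<phi> ` ?O) (\<lambda>y. transition c c'' (\<eta> y))"
    proof (rule smooth_on_compose[OF op open_overlap[OF c c''] _ transition_smooth[OF c c'']])
      show "\<eta> ` \<phi> ` ?O \<subseteq> coord c ` (chart_dom c \<inter> chart_dom c'')"
      proof (rule image_subsetI)
        fix y assume "y \<in> \<phi> ` ?O"
        then obtain x where "x \<in> ?O" "y = \<phi> x" by blast
        then show "\<eta> y \<in> coord c ` (chart_dom c \<inter> chart_dom c'')"
          using O \<eta>[of x] by auto
      qed
      show "smooth_on (\<phi> ` ?O) \<eta>" by (rule smooth_on_subset[OF sm(2)]) (use O in auto)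
    qed
    then show "smooth_on (coord c' ` (chart_dom c' \<inter> chart_dom c'')) (transition c' c'')"
      unfolding im
      by (rule iffD1[OF smooth_on_cong[OF op], rotated])
        (use O(1) \<eta> invc' in \<open>auto simp: transition_def\<close>)
    have im2: "coord c'' ` (chart_dom c' \<inter> chart_dom c'') = coord c'' ` (chart_dom c'' \<inter> V)"
      by (auto simp: c'_def)
    have op2: "open (coord c'' ` (chart_dom c'' \<inter> V))"
      by (rule open_coord_image[OF c'' oV])
    have "smooth_on (coord c'' ` (chart_dom c'' \<inter> V)) (\<lambda>y. \<phi> (transition c'' c y))"
    proof (rule smooth_on_compose[OF op2 U(1) _ sm(1)])
      show "transition c'' c ` coord c'' ` (chart_dom c'' \<inter> V) \<subseteq> U"
        using transition_coord[OF c'', of _ c] by (auto simp: V)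
      show "smooth_on (coord c'' ` (chart_dom c'' \<inter> V)) (transition c'' c)"
        by (rule smooth_on_subset[OF transition_smooth[OF c'' c]]) (use Vsub in auto)
    qed
    then show "smooth_on (coord c'' ` (chart_dom c' \<inter> chart_dom c'')) (transition c'' c')"
      unfolding im2
      by (rule iffD1[OF smooth_on_cong[OF op2], rotated])
        (auto simp: transition_def c'_def)
  qed
  with chart M show ?thesis
    unfolding c'_def V_def smooth_manifold_def by blast
qed

text \<open>The equation for the second derivative of \<open>\<phi>\<close> says precisely that the
  inhomogeneous term in the transformation of the Christoffel symbols accounts for all of them, so
  they vanish in the new chart. The two extra properties have different uses: convexity provides the
  straight segments, connectedness the constancy of \<open>g\<close> granted by
  \<open>pseudo_Euclidean_manifold\<close>.\<close>

lemma affine_chart_exists: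
  fixes D :: "('m, 'n) connection"
  assumes D: "flat_connection A D" and p: "p \<in> topspace M"
  shows "\<exists>c\<in>affine_charts A D. p \<in> chart_dom c \<and> convex (coord c ` chart_dom c) \<and> connectedin M (chart_dom c)"
proof -
  obtain c where c: "c \<in> A" "p \<in> chart_dom c" using chart_exists[OF p] by blast
  let ?S = "coord c ` chart_dom c"
  have D1: "affine_connection A D" "torsion_free A D"
    and D2: "curvature D c q u v w = 0" if "q \<in> chart_dom c" for q u v w
    using D c that by (auto simp: flat_connection_def)
  have S: "open ?S" "coord c p \<in> ?S" using chartD[OF c(1)] c by auto
  obtain U and \<phi> \<eta> :: "real ^ 'n \<Rightarrow> real ^ 'n" where U: "open U" "coord c p \<in> U" "U \<subseteq> ?S" "open (\<phi> ` U)"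
    and sm: "smooth_on U \<phi>" "smooth_on (\<phi> ` U) \<eta>" "\<And>x. x \<in> U \<Longrightarrow> \<eta> (\<phi> x) = x"
    and su: "\<And>x. x \<in> U \<Longrightarrow> surj (frechet_derivative \<phi> (at x))"
    and sd: "\<And>x u v. x \<in> U \<Longrightarrow> second_derivative \<phi> x u v = frechet_derivative \<phi> (at x) (D c (inv_coord c x) u v)"
  proof (rule flat_coordinates[OF S, of "\<lambda>x. D c (inv_coord c x)"])
    show "bilinear (D c (inv_coord c x))" "D c (inv_coord c x) u v = D c (inv_coord c x) v u"
      if "x \<in> ?S" for x u v
      using D1 c inv_coord_in[OF that] by (auto simp: affine_connection_def torsion_free_def)
    show "smooth_on ?S (\<lambda>x. D c (inv_coord c x) u v)" for u v
      using D1 c by (auto simp: affine_connection_def)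
    show "frechet_derivative (\<lambda>x. D c (inv_coord c x) v w) (at x) u
       - frechet_derivative (\<lambda>x. D c (inv_coord c x) u w) (at x) v
       + D c (inv_coord c x) u (D c (inv_coord c x) v w) - D c (inv_coord c x) v (D c (inv_coord c x) u w) = 0"
      if "x \<in> ?S" for x u v w
      using D2[OF inv_coord_in[OF that], of u v w] coord_inv_coord[OF that] by (simp add: curvature_def)
    fix U and \<phi> \<eta> :: "real ^ 'n \<Rightarrow> real ^ 'n"
    assume "open U" "coord c p \<in> U" "U \<subseteq> ?S" "open (\<phi> ` U)" "smooth_on U \<phi>" "smooth_on (\<phi> ` U) \<eta>"
      "\<And>x. x \<in> U \<Longrightarrow> \<eta> (\<phi> x) = x" "\<And>x. x \<in> U \<Longrightarrow> surj (frechet_derivative \<phi> (at x))"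
      "\<And>x u v. x \<in> U \<Longrightarrow> second_derivative \<phi> x u v = frechet_derivative \<phi> (at x) (D c (inv_coord c x) u v)"
    then show thesis by (rule that)
  qed
  obtain \<epsilon> where \<epsilon>: "\<epsilon> > 0" "ball (\<phi> (coord c p)) \<epsilon> \<subseteq> \<phi> ` U"
    using U open_contains_ball by blast
  define W where "W = {x \<in> U. \<phi> x \<in> ball (\<phi> (coord c p)) \<epsilon>}"
  have W: "open W" "coord c p \<in> W" "W \<subseteq> U" "\<phi> ` W = ball (\<phi> (coord c p)) \<epsilon>"
  proof -
    show "open W"
      using continuous_open_preimage[OF smooth_on_imp_continuous_on[OF sm(1)] U(1) open_ball]
      by (simp add: W_def vimage_def Int_def)
  qed (use U \<epsilon> in \<open>auto simp: W_def\<close>)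
  define c' where "c' = (inv_coord c ` W, \<phi> \<circ> coord c)"
  have c'A: "c' \<in> A"
    unfolding c'_def
  proof (rule reparametrized_chart[OF c(1) W(1)])
    show "open (\<phi> ` W)" unfolding W(4) by simp
    show "smooth_on W \<phi>" "smooth_on (\<phi> ` W) \<eta>"
      using W(3) by (auto intro: smooth_on_subset[OF sm(1)] smooth_on_subset[OF sm(2)])
  qed (use W U sm(3) in auto)
  have dom: "chart_dom c' = {q \<in> chart_dom c. coord c q \<in> W}"
    using W(3) U(3) coord_inv_coord inv_coord_in inv_coord_coord[OF c(1)]
    unfolding c'_def by (force simp: image_iff)
  have im: "coord c' ` chart_dom c' = ball (\<phi> (coord c p)) \<epsilon>"
  proof -
    have "coord c ` chart_dom c' = W" using W(3) U(3) unfolding dom by auto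
    then have "(\<phi> \<circ> coord c) ` chart_dom c' = \<phi> ` W" by (metis image_comp)
    then show ?thesis unfolding W(4) by (simp add: c'_def)
  qed
  have "D c' q u v = 0" if q: "q \<in> chart_dom c'" for q u v
  proof -
    have q': "q \<in> chart_dom c" "coord c q \<in> W" "coord c q \<in> U" using q W(3) by (auto simp: dom)
    have tr: "transition c c' x = \<phi> x" if "x \<in> W" for x
      using that W(3) U(3) by (auto simp: transition_def c'_def coord_inv_coord)
    have cv: "change_vec c c' q = frechet_derivative \<phi> (at (coord c q))"
      unfolding change_vec_def[abs_def] by (rule frechet_derivative_cong_open[OF W(1) q'(2) tr])
    have "change_vec c c' q (D c q u v) =
        second_derivative (transition c c') (coord c q) u v + D c' q (change_vec c c' q u) (change_vec c c' q v)" for u v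
      using D1(1) c(1) c'A q q' unfolding affine_connection_def by blast
    moreover have "second_derivative (transition c c') (coord c q) u v = change_vec c c' q (D c q u v)" for u v
      using second_derivative_cong_open[OF W(1) q'(2), of "transition c c'" \<phi> u v] tr sd[OF q'(3), of u v]
      by (simp add: cv inv_coord_coord[OF c(1) q'(1)])
    ultimately have "D c' q (change_vec c c' q u) (change_vec c c' q v) = 0" for u v by simp
    \<comment> \<open>So far the new symbols vanish only on vectors in the range of the Jacobian;
      surjectivity reaches all vectors.\<close>
    moreover have "surj (change_vec c c' q)" unfolding cv by (rule su[OF q'(3)])
    ultimately show ?thesis by (metis surjD)
  qed
  then have "c' \<in> affine_charts A D" using c'A by (simp add: affine_charts_def)
  moreover have "p \<in> chart_dom c'" using c W by (simp add: dom)
  moreover have "connectedin M (chart_dom c')"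
  proof -
    have "connectedin (top_of_set (coord c' ` chart_dom c')) (coord c' ` chart_dom c')"
      unfolding im by (simp add: connectedin_subtopology)
    then have "connectedin (subtopology M (chart_dom c')) (chart_dom c')"
      using homeomorphic_map_connectedness[OF chartD(4)[OF c'A], of "chart_dom c'"] chartD(5)[OF c'A]
        chartD(3)[OF c'A] by simp
    then show ?thesis by (simp add: connectedin_subtopology)
  qed
  ultimately show ?thesis using im by (metis convex_ball)
qed

end

subsection \<open>Tensors and connections in charts\<close>

lemma pseudo_metricD:
  assumes "pseudo_metric A g" "c \<in> A" "p \<in> chart_dom c"
  shows "bilinear (g c p)" "g c p u v = g c p v u" "(\<And>v. g c p u v = 0) \<Longrightarrow> u = 0"
    "c' \<in> A \<Longrightarrow> p \<in> chart_dom c' \<Longrightarrow> g c p u v = g c' p (change_vec c c' p u) (change_vec c c' p v)"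
  using assms unfolding pseudo_metric_def by blast+

lemma pseudo_metric_smooth:
  "pseudo_metric A g \<Longrightarrow> c \<in> A \<Longrightarrow> smooth_on (coord c ` chart_dom c) (\<lambda>x. g c (inv_coord c x) u v)"
  unfolding pseudo_metric_def by blast

context
  fixes M :: "'m topology" and A :: "('m, 'n::finite) chart set"
  assumes M: "smooth_manifold M A"
begin

lemmas in_chart [simp] = inv_coord_coord[OF M] coord_inv_coord[OF M] inv_coord_in[OF M]

lemma smooth_function_chart:
  assumes "smooth_function A (topspace M) f" "c \<in> A"
  shows "smooth_on (coord c ` chart_dom c) (f \<circ> inv_coord c)"
proof -
  have "chart_dom c \<inter> topspace M = chart_dom c" using chartD(3)[OF M assms(2)] by auto
  then show ?thesis using assms by (auto simp: smooth_function_def)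
qed

lemma differential_derivative:
  assumes "smooth_function A (topspace M) f" "c \<in> A" "p \<in> chart_dom c"
  shows "((f \<circ> inv_coord c) has_derivative differential c f p) (at (coord c p))"
  unfolding differential_def[abs_def]
  by (rule smooth_on_has_derivative[OF smooth_function_chart[OF assms(1,2)]]) (use assms in auto)

lemma differential_change:
  assumes f: "smooth_function A (topspace M) f" and c: "c \<in> A" "c' \<in> A" "p \<in> chart_dom c" "p \<in> chart_dom c'"
  shows "differential c f p u = differential c' f p (change_vec c c' p u)"
proof -
  let ?O = "coord c ` (chart_dom c \<inter> chart_dom c')"
  have O: "open ?O" "coord c p \<in> ?O" using open_overlap[OF M] c by auto
  have "((f \<circ> inv_coord c') has_derivative differential c' f p) (at (transition c c' (coord c p)))"
    using differential_derivative[OF f c(2,4)] by (simp add: transition_coord[OF M c(1,3)])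
  from has_derivative_compose[OF transition_derivative[OF M c] this]
  have "((f \<circ> inv_coord c) has_derivative (\<lambda>u. differential c' f p (change_vec c c' p u))) (at (coord c p))"
    by (rule has_derivative_transform_within_open[OF _ O])
      (use c in \<open>auto simp: transition_coord[OF M c(1)] inv_coord_coord[OF M]\<close>)
  from has_derivative_unique[OF this differential_derivative[OF f c(1,3)]]
  show ?thesis by metis
qed

section \<open>The hybrid connection and rescaled metrics\<close>

text \<open>The correction term is tensorial, since the differential of \<open>\<psi>\<close>
  transforms as a covector; the inhomogeneous second derivative in the change of charts is thus
  inherited from \<open>D\<close> unaltered.\<close>

lemma affine_connection_hybrid:
  assumes D: "affine_connection A D" and \<psi>: "smooth_function A (topspace M) \<psi>"
    "\<And>p. p \<in> topspace M \<Longrightarrow> \<psi> p \<noteq> 0"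
  shows "affine_connection A (hybrid_connection D \<psi>)"
  unfolding affine_connection_def
proof (intro conjI ballI allI)
  fix c p assume c: "c \<in> A" and p: "p \<in> chart_dom c"
  have bil: "bilinear (D c p)" using D c p by (auto simp: affine_connection_def)
  have lin: "linear (differential c \<psi> p)"
    using has_derivative_linear[OF differential_derivative[OF \<psi>(1) c p]] .
  show "bilinear (hybrid_connection D \<psi> c p)"
    unfolding bilinear_def hybrid_connection_def
    by (auto intro!: linearI simp: bilinear_radd[OF bil] bilinear_ladd[OF bil] bilinear_rmul[OF bil]
        bilinear_lmul[OF bil] linear_add[OF lin] linear_scale[OF lin] algebra_simps add_divide_distrib)
next
  fix c u v assume c: "c \<in> A"
  let ?S = "coord c ` chart_dom c"
  have S: "open ?S" by (rule chartD(2)[OF M c])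
  have sm: "smooth_on ?S (\<lambda>x. (\<psi> \<circ> inv_coord c) x)"
    using smooth_function_chart[OF \<psi>(1) c] .
  have nz: "(\<psi> \<circ> inv_coord c) x \<noteq> 0" if "x \<in> ?S" for x
    using that \<psi>(2) chartD(3)[OF M c] c by auto
  have "smooth_on ?S (\<lambda>x. frechet_derivative (\<psi> \<circ> inv_coord c) (at x) w)" for w
    by (rule smooth_on_frechet_derivative[OF smooth_function_chart[OF \<psi>(1) c]])
  then have "smooth_on ?S (\<lambda>x. D c (inv_coord c x) u v - inverse ((\<psi> \<circ> inv_coord c) x) *\<^sub>R
      (frechet_derivative (\<psi> \<circ> inv_coord c) (at x) u *\<^sub>R v + frechet_derivative (\<psi> \<circ> inv_coord c) (at x) v *\<^sub>R u))"
    using D c by (intro smooth_on_diff smooth_on_scaleR smooth_on_inverse smooth_on_add S sm nz smooth_on_const)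
      (auto simp: affine_connection_def)
  then show "smooth_on ?S (\<lambda>x. hybrid_connection D \<psi> c (inv_coord c x) u v)"
    by (rule iffD1[OF smooth_on_cong[OF S], rotated])
      (auto simp: hybrid_connection_def differential_def inverse_eq_divide c)
next
  fix c c' p u v
  assume c: "c \<in> A" "c' \<in> A" and "p \<in> chart_dom c \<inter> chart_dom c'"
  then have p: "p \<in> chart_dom c" "p \<in> chart_dom c'" by auto
  note lin = linear_change_vec[OF M c p]
  have "change_vec c c' p (D c p u v) = second_derivative (transition c c') (coord c p) u v +
      D c' p (change_vec c c' p u) (change_vec c c' p v)"
    using D c p by (auto simp: affine_connection_def)
  then show "change_vec c c' p (hybrid_connection D \<psi> c p u v) =
      second_derivative (transition c c') (coord c p) u v +
      hybrid_connection D \<psi> c' p (change_vec c c' p u) (change_vec c c' p v)"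
    by (simp add: hybrid_connection_def linear_diff[OF lin] linear_add[OF lin] linear_scale[OF lin]
        differential_change[OF \<psi>(1) c p])
qed

lemma pseudo_metric_scale:
  assumes g: "pseudo_metric A g" and \<rho>: "smooth_function A (topspace M) \<rho>"
    "\<And>p. p \<in> topspace M \<Longrightarrow> \<rho> p \<noteq> 0"
  shows "pseudo_metric A (scale_tensor \<rho> g)"
  unfolding pseudo_metric_def
proof (intro conjI ballI allI impI)
  fix c p assume c: "c \<in> A" and p: "p \<in> chart_dom c"
  note gD = pseudo_metricD[OF g c p]
  note bil = gD(1)
  then show "bilinear (scale_tensor \<rho> g c p)"
    unfolding bilinear_def scale_tensor_def
    by (auto intro!: linearI simp: bilinear_radd[OF bil] bilinear_ladd[OF bil] bilinear_rmul[OF bil]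
        bilinear_lmul[OF bil] algebra_simps)
  show "scale_tensor \<rho> g c p u v = scale_tensor \<rho> g c p v u" for u v
    unfolding scale_tensor_def gD(2)[of u v] ..
  show "u = 0" if "\<forall>v. scale_tensor \<rho> g c p u v = 0" for u
  proof (rule gD(3))
    have "p \<in> topspace M" using chartD(3)[OF M c] p by blast
    from \<rho>(2)[OF this] show "g c p u v = 0" for v using that by (simp add: scale_tensor_def)
  qed
next
  fix c u v assume c: "c \<in> A"
  have "smooth_on (coord c ` chart_dom c) (\<lambda>x. (\<rho> \<circ> inv_coord c) x * g c (inv_coord c x) u v)"
    by (intro smooth_on_mult chartD(2)[OF M] smooth_function_chart[OF \<rho>(1)] pseudo_metric_smooth[OF g] c)
  then show "smooth_on (coord c ` chart_dom c) (\<lambda>x. scale_tensor \<rho> g c (inv_coord c x) u v)"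
    by (simp add: scale_tensor_def)
next
  fix c c' p u v assume "c \<in> A" "c' \<in> A" "p \<in> chart_dom c \<inter> chart_dom c'"
  then show "scale_tensor \<rho> g c p u v = scale_tensor \<rho> g c' p (change_vec c c' p u) (change_vec c c' p v)"
    unfolding scale_tensor_def by (metis IntD1 IntD2 pseudo_metricD(4)[OF g])
qed

lemma smooth_function_inverse_power:
  assumes "smooth_function A (topspace M) \<psi>" "\<And>p. p \<in> topspace M \<Longrightarrow> \<psi> p \<noteq> 0"
  shows "smooth_function A (topspace M) (\<lambda>p. a / \<psi> p ^ k)"
  unfolding smooth_function_def
proof
  fix c assume c: "c \<in> A"
  let ?S = "coord c ` chart_dom c"
  have nz: "(\<psi> \<circ> inv_coord c) x \<noteq> 0" if "x \<in> ?S" for x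
    using that assms(2) chartD(3)[OF M c] c by auto
  have "smooth_on ?S (\<lambda>x. a * inverse ((\<psi> \<circ> inv_coord c) x) ^ k)"
    by (intro smooth_on_mult smooth_on_power smooth_on_inverse smooth_on_const chartD(2)[OF M c] nz
        smooth_function_chart[OF assms(1) c])
  then have "smooth_on ?S ((\<lambda>p. a / \<psi> p ^ k) \<circ> inv_coord c)"
    by (simp add: o_def divide_inverse power_inverse)
  then show "smooth_on (coord c ` (chart_dom c \<inter> topspace M)) ((\<lambda>p. a / \<psi> p ^ k) \<circ> inv_coord c)"
    by (rule smooth_on_subset) auto
qed

subsection \<open>Curves\<close>

text \<open>Only continuity of the curve is assumed, so that this also serves while the smoothness
  of a curve is still being proved.\<close>

lemma open_in_chart_vimage:
  assumes "open I" "continuous_map (top_of_set I) M \<gamma>" "c \<in> A"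
  shows "open {t \<in> I. \<gamma> t \<in> chart_dom c}"
proof -
  have "openin (top_of_set I) {t \<in> topspace (top_of_set I). \<gamma> t \<in> chart_dom c}"
    by (rule openin_continuous_map_preimage[OF assms(2) chartD(1)[OF M assms(3)]])
  from openin_open_trans[OF this assms(1)] show ?thesis by simp
qed

context
  fixes I :: "real set" and \<gamma> :: "real \<Rightarrow> 'm"
  assumes I: "open I" and \<gamma>: "smooth_curve M A I \<gamma>"
begin

lemma open_curve_in_chart: "c \<in> A \<Longrightarrow> open {t \<in> I. \<gamma> t \<in> chart_dom c}"
  using \<gamma> by (intro open_in_chart_vimage I) (auto simp: smooth_curve_def)

lemma smooth_on_curve_in_chart: "c \<in> A \<Longrightarrow> smooth_on {t \<in> I. \<gamma> t \<in> chart_dom c} (coord c \<circ> \<gamma>)"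
  using \<gamma> by (simp add: smooth_curve_def)

text \<open>The second form exhibits the velocity as a Frechet derivative, to which the smoothness
  lemmas apply; this is how the velocity is seen to be differentiable.\<close>

lemma velocity_has_vector_derivative:
  assumes "c \<in> A" "t \<in> I" "\<gamma> t \<in> chart_dom c"
  shows "((coord c \<circ> \<gamma>) has_vector_derivative velocity c \<gamma> t) (at t)"
    and velocity_eq_frechet: "velocity c \<gamma> t = frechet_derivative (coord c \<circ> \<gamma>) (at t) 1"
proof -
  have "(coord c \<circ> \<gamma>) differentiable (at t)"
    using smooth_on_has_derivative[OF smooth_on_curve_in_chart[OF assms(1)]] assms(2,3)
    by (auto simp: differentiable_def)
  then show "((coord c \<circ> \<gamma>) has_vector_derivative velocity c \<gamma> t) (at t)"
    "velocity c \<gamma> t = frechet_derivative (coord c \<circ> \<gamma>) (at t) 1"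
    by (simp_all add: velocity_def vector_derivative_works frechet_derivative_eq_vector_derivative)
qed

lemma velocity_derivative:
  assumes c: "c \<in> A" "t \<in> I" "\<gamma> t \<in> chart_dom c"
  shows "(velocity c \<gamma> has_vector_derivative vector_derivative (velocity c \<gamma>) (at t)) (at t)"
proof -
  let ?O = "{t \<in> I. \<gamma> t \<in> chart_dom c}"
  have "smooth_on ?O (\<lambda>t. frechet_derivative (coord c \<circ> \<gamma>) (at t) 1)"
    by (rule smooth_on_frechet_derivative[OF smooth_on_curve_in_chart[OF c(1)]])
  then have "smooth_on ?O (velocity c \<gamma>)"
    by (rule iffD1[OF smooth_on_cong[OF open_curve_in_chart[OF c(1)]], rotated])
      (auto simp: velocity_eq_frechet c(1))
  then have "velocity c \<gamma> differentiable (at t)"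
    using smooth_on_has_derivative[of ?O "velocity c \<gamma>" t] c by (auto simp: differentiable_def)
  then show ?thesis by (simp add: vector_derivative_works)
qed

lemma velocity_change:
  assumes c: "c \<in> A" "c' \<in> A" and t: "t \<in> I" "\<gamma> t \<in> chart_dom c" "\<gamma> t \<in> chart_dom c'"
  shows "velocity c' \<gamma> t = change_vec c c' (\<gamma> t) (velocity c \<gamma> t)"
proof -
  let ?O = "{t \<in> I. \<gamma> t \<in> chart_dom c}"
  have "((coord c \<circ> \<gamma>) has_derivative (\<lambda>s. s *\<^sub>R velocity c \<gamma> t)) (at t)"
    using velocity_has_vector_derivative[OF c(1) t(1,2)] by (simp add: has_vector_derivative_def)
  moreover have "(transition c c' has_derivative change_vec c c' (\<gamma> t)) (at ((coord c \<circ> \<gamma>) t))"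
    using transition_derivative[OF M c t(2,3)] by simp
  ultimately have "((\<lambda>s. transition c c' ((coord c \<circ> \<gamma>) s)) has_derivative
      (\<lambda>s. change_vec c c' (\<gamma> t) (s *\<^sub>R velocity c \<gamma> t))) (at t)"
    by (rule has_derivative_compose)
  then have "((coord c' \<circ> \<gamma>) has_derivative (\<lambda>s. change_vec c c' (\<gamma> t) (s *\<^sub>R velocity c \<gamma> t))) (at t)"
    by (rule has_derivative_transform_within_open[OF _ open_curve_in_chart[OF c(1)]])
      (use t in \<open>auto simp: transition_coord[OF M c(1)]\<close>)
  then have "((coord c' \<circ> \<gamma>) has_vector_derivative change_vec c c' (\<gamma> t) (velocity c \<gamma> t)) (at t)"
    by (simp add: has_vector_derivative_def linear_scale[OF linear_change_vec[OF M c t(2,3)]])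
  then show ?thesis
    using velocity_has_vector_derivative[OF c(2) t(1,3)] vector_derivative_unique_at by blast
qed

lemma potential_along_curve:
  assumes f: "smooth_function A (topspace M) f" and c: "c \<in> A" "t \<in> I" "\<gamma> t \<in> chart_dom c"
  shows "((\<lambda>t. f (\<gamma> t)) has_real_derivative differential c f (\<gamma> t) (velocity c \<gamma> t)) (at t)"
proof -
  have "((coord c \<circ> \<gamma>) has_derivative (\<lambda>s. s *\<^sub>R velocity c \<gamma> t)) (at t)"
    using velocity_has_vector_derivative[OF c] by (simp add: has_vector_derivative_def)
  moreover have d: "((f \<circ> inv_coord c) has_derivative differential c f (\<gamma> t)) (at ((coord c \<circ> \<gamma>) t))"
    using differential_derivative[OF f c(1,3)] by simp
  ultimately have "((\<lambda>s. (f \<circ> inv_coord c) ((coord c \<circ> \<gamma>) s)) has_derivative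
      (\<lambda>s. differential c f (\<gamma> t) (s *\<^sub>R velocity c \<gamma> t))) (at t)"
    by (rule has_derivative_compose)
  then have "((\<lambda>t. f (\<gamma> t)) has_derivative (\<lambda>s. differential c f (\<gamma> t) (s *\<^sub>R velocity c \<gamma> t))) (at t)"
    by (rule has_derivative_transform_within_open[OF _ open_curve_in_chart[OF c(1)]])
      (use c in auto)
  moreover have "(\<lambda>s. differential c f (\<gamma> t) (s *\<^sub>R velocity c \<gamma> t)) = (*) (differential c f (\<gamma> t) (velocity c \<gamma> t))"
    by (rule ext) (simp add: linear_scale[OF has_derivative_linear[OF d]])
  ultimately show ?thesis by (simp only: has_field_derivative_def)
qed

text \<open>The geodesic equation reads \<open>x'' = (2 * d / q) x'\<close> with \<open>q\<close>
  the potential and \<open>d\<close> its derivative along the curve. Hence \<open>b x' x'\<close> is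
  multiplied by \<open>4 * d / q\<close> under differentiation and the inverse fourth power of
  \<open>q\<close> by \<open>- 4 * d / q\<close>, and the two cancel. The form \<open>b\<close> is
  independent of the point; a metric that varied in the chart would contribute a derivative of its
  own.\<close>

lemma speed_derivative_zero:
  assumes \<psi>: "smooth_function A (topspace M) \<psi>" "\<And>p. p \<in> topspace M \<Longrightarrow> \<psi> p \<noteq> 0"
    and c: "c \<in> affine_charts A D" "t \<in> I" "\<gamma> t \<in> chart_dom c"
    and b: "bilinear b"
    and geo: "vector_derivative (velocity c \<gamma>) (at t) +
        hybrid_connection D \<psi> c (\<gamma> t) (velocity c \<gamma> t) (velocity c \<gamma> t) = 0"
  shows "((\<lambda>t. a / \<psi> (\<gamma> t) ^ 4 * b (velocity c \<gamma> t) (velocity c \<gamma> t)) has_real_derivative 0) (at t)"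
proof -
  have cA: "c \<in> A" and D0: "D c (\<gamma> t) u v = 0" for u v
    using c by (auto simp: affine_charts_def)
  have nz: "\<psi> (\<gamma> t) \<noteq> 0" using \<psi>(2) chartD(3)[OF M cA] c by auto
  define v where "v = velocity c \<gamma> t"
  define q where "q = \<psi> (\<gamma> t)"
  define d where "d = differential c \<psi> (\<gamma> t) v"
  have "vector_derivative (velocity c \<gamma>) (at t) = (2 * d / q) *\<^sub>R v"
    using geo D0 by (simp add: hybrid_connection_def v_def[symmetric] d_def[symmetric] q_def[symmetric]
        scaleR_left_distrib[symmetric])
  then have v': "(velocity c \<gamma> has_derivative (\<lambda>s. s *\<^sub>R (2 * d / q) *\<^sub>R v)) (at t)"
    using velocity_derivative[OF cA c(2,3)] by (simp add: has_vector_derivative_def)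
  have bb: "bounded_bilinear b" using b bilinear_conv_bounded_bilinear by blast
  have "((\<lambda>t. b (velocity c \<gamma> t) (velocity c \<gamma> t)) has_derivative (*) (4 * d / q * b v v)) (at t)"
    by (rule has_derivative_eq_rhs[OF bounded_bilinear.FDERIV[OF bb v' v']])
      (simp add: v_def[symmetric] fun_eq_iff bounded_bilinear.scaleR_left[OF bb] bounded_bilinear.scaleR_right[OF bb])
  then have b': "((\<lambda>t. b (velocity c \<gamma> t) (velocity c \<gamma> t)) has_real_derivative 4 * d / q * b v v) (at t)"
    by (simp only: has_field_derivative_def)
  have q': "((\<lambda>t. \<psi> (\<gamma> t)) has_real_derivative d) (at t)"
    unfolding d_def v_def by (rule potential_along_curve[OF \<psi>(1) cA c(2,3)])
  have p: "((\<lambda>t. a / \<psi> (\<gamma> t) ^ 4) has_real_derivative - (4 * a * d) / q ^ 5) (at t)"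
    using nz
    by (intro DERIV_cong[OF DERIV_divide[OF DERIV_const DERIV_power[OF q', of 4]]])
      (simp_all add: q_def[symmetric] field_simps eval_nat_numeral)
  show ?thesis
    using nz
    by (intro DERIV_cong[OF DERIV_mult[OF p b']])
      (simp add: v_def[symmetric] q_def[symmetric] field_simps eval_nat_numeral)
qed

end

end

subsection \<open>Geodesics\<close>

lemma frechet_derivative_expand:
  fixes f :: "'a::euclidean_space \<Rightarrow> 'b::real_normed_vector"
  assumes "smooth_on S f" "x \<in> S"
  shows "frechet_derivative f (at x) w = (\<Sum>i\<in>Basis. (w \<bullet> i) *\<^sub>R frechet_derivative f (at x) i)"
proof -
  have "linear (frechet_derivative f (at x))"
    using has_derivative_linear[OF smooth_on_has_derivative[OF assms]] .
  then show ?thesis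
    by (subst euclidean_representation[of w, symmetric]) (simp only: linear_sum linear_scale)
qed

lemma second_derivative_has_derivative:
  assumes "smooth_on S f" "x \<in> S"
  shows "((\<lambda>y. frechet_derivative f (at y) w) has_derivative (\<lambda>u. second_derivative f x u w)) (at x)"
  unfolding second_derivative_def
  by (rule smooth_on_has_derivative[OF smooth_on_frechet_derivative[OF assms(1)] assms(2)])

text \<open>Linearity in \<open>u\<close> is that of a derivative. In \<open>w\<close> it holds
  because the expansion of the inner derivative is valid throughout the open set \<open>S\<close>
  and may be differentiated.\<close>

lemma second_derivative_expand:
  fixes f :: "'a::euclidean_space \<Rightarrow> 'b::real_normed_vector"
  assumes S: "open S" "smooth_on S f" "x \<in> S"
  shows "second_derivative f x u w = (\<Sum>i\<in>Basis. (w \<bullet> i) *\<^sub>R second_derivative f x u i)"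
proof -
  have "((\<lambda>y. \<Sum>i\<in>Basis. (w \<bullet> i) *\<^sub>R frechet_derivative f (at y) i) has_derivative
      (\<lambda>u. \<Sum>i\<in>Basis. (w \<bullet> i) *\<^sub>R second_derivative f x u i)) (at x)"
    by (intro has_derivative_sum has_derivative_scaleR_right second_derivative_has_derivative[OF S(2,3)])
  then have "((\<lambda>y. frechet_derivative f (at y) w) has_derivative
      (\<lambda>u. \<Sum>i\<in>Basis. (w \<bullet> i) *\<^sub>R second_derivative f x u i)) (at x)"
    by (rule has_derivative_transform_within_open[OF _ S(1,3)])
      (rule frechet_derivative_expand[OF S(2), symmetric])
  from has_derivative_unique[OF second_derivative_has_derivative[OF S(2,3)] this]
  show ?thesis by metis
qed

text \<open>Base point and direction both depend on \<open>s\<close>; after expanding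
  \<open>V s\<close> in the basis the product rule applies to each term. With a transition map for
  \<open>f\<close> this is the transformation law of accelerations, whose second derivative term
  matches that of a connection.\<close>

lemma acceleration_chain_rule:
  fixes f :: "'a::euclidean_space \<Rightarrow> 'b::real_normed_vector"
  assumes S: "open S" "smooth_on S f" and J: "open J" "t \<in> J" "X ` J \<subseteq> S"
    and X: "(X has_vector_derivative V t) (at t)" and V: "(V has_vector_derivative W) (at t)"
  shows "((\<lambda>s. frechet_derivative f (at (X s)) (V s)) has_vector_derivative
    second_derivative f (X t) (V t) (V t) + frechet_derivative f (at (X t)) W) (at t)"
proof -
  have XS: "X s \<in> S" if "s \<in> J" for s using J(3) that by auto
  let ?D = "\<lambda>i s. frechet_derivative f (at (X s)) i"
  have "(?D i has_derivative (\<lambda>s. second_derivative f (X t) (s *\<^sub>R V t) i)) (at t)" for i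
    using has_derivative_compose[OF X[unfolded has_vector_derivative_def]
        second_derivative_has_derivative[OF S(2) XS[OF J(2)], of i]] .
  moreover have "second_derivative f (X t) (s *\<^sub>R V t) i = s *\<^sub>R second_derivative f (X t) (V t) i" for s i
    using has_derivative_linear[OF second_derivative_has_derivative[OF S(2) XS[OF J(2)], of i]]
    by (rule linear_scale)
  ultimately have D: "(?D i has_vector_derivative second_derivative f (X t) (V t) i) (at t)" for i
    by (simp add: has_vector_derivative_def)
  have Vi: "((\<lambda>s. V s \<bullet> i) has_real_derivative W \<bullet> i) (at t)" for i
    using bounded_linear.has_vector_derivative[OF bounded_linear_inner_left V, of i]
    by (simp add: has_real_derivative_iff_has_vector_derivative)
  have "((\<lambda>s. \<Sum>i\<in>Basis. (V s \<bullet> i) *\<^sub>R ?D i s) has_vector_derivative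
      (\<Sum>i\<in>Basis. (V t \<bullet> i) *\<^sub>R second_derivative f (X t) (V t) i + (W \<bullet> i) *\<^sub>R ?D i t)) (at t)"
    by (intro has_vector_derivative_sum has_vector_derivative_scaleR Vi D)
  moreover have "(\<Sum>i\<in>Basis. (V t \<bullet> i) *\<^sub>R second_derivative f (X t) (V t) i + (W \<bullet> i) *\<^sub>R ?D i t) =
      second_derivative f (X t) (V t) (V t) + frechet_derivative f (at (X t)) W"
    unfolding sum.distrib
    by (simp only: second_derivative_expand[OF S XS[OF J(2)], of "V t" "V t"]
        frechet_derivative_expand[OF S(2) XS[OF J(2)], of W])
  ultimately have "((\<lambda>s. \<Sum>i\<in>Basis. (V s \<bullet> i) *\<^sub>R ?D i s) has_vector_derivative
      second_derivative f (X t) (V t) (V t) + frechet_derivative f (at (X t)) W) (at t)" by simp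
  then show ?thesis
    by (rule has_vector_derivative_transform_within_open[OF _ J(1,2)])
      (rule frechet_derivative_expand[OF S(2) XS, symmetric])
qed

text \<open>Separation of variables: \<open>\<tau>\<close> is an antiderivative of
  \<open>1 / f\<close> and \<open>\<sigma>\<close> its inverse. The time interval is whatever
  \<open>\<tau>\<close> produces, but the solution runs through all of \<open>{a<..<b}\<close>,
  which is what reaching both endpoints of a segment requires. Smoothness follows by bootstrapping
  \<open>\<sigma>' = f \<circ> \<sigma>\<close>.\<close>

lemma autonomous_ode_solution:
  fixes f :: "real \<Rightarrow> real"
  assumes ab: "a < b" and f: "smooth_on {a<..<b} f" "\<And>s. s \<in> {a<..<b} \<Longrightarrow> f s > 0"
  obtains I \<sigma> where "open I" "is_interval I" "\<sigma> ` I = {a<..<b}" "smooth_on I \<sigma>"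
    "\<forall>t\<in>I. (\<sigma> has_real_derivative f (\<sigma> t)) (at t)"
proof -
  let ?J = "{a<..<b}"
  have "isCont (\<lambda>s. 1 / f s) s" if "a < s" "s < b" for s
  proof -
    have "continuous_on ?J (\<lambda>s. 1 / f s)"
      using smooth_on_imp_continuous_on[OF f(1)] f(2) by (intro continuous_intros) force+
    then show ?thesis using that by (simp add: continuous_on_eq_continuous_at)
  qed
  \<comment> \<open>Nothing is known about \<open>f\<close> at the ends, so the antiderivative is
    taken on the open interval.\<close>
  then obtain \<tau> where \<tau>: "\<And>s. s \<in> ?J \<Longrightarrow> (\<tau> has_vector_derivative 1 / f s) (at s)"
    using einterval_antiderivative[of "ereal a" "ereal b" "\<lambda>s. 1 / f s"] ab by auto
  have d\<tau>: "(\<tau> has_real_derivative 1 / f s) (at s)" if "s \<in> ?J" for s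
    using \<tau>[OF that] by (simp add: has_real_derivative_iff_has_vector_derivative)
  have less: "\<tau> s < \<tau> s'" if "s \<in> ?J" "s' \<in> ?J" "s < s'" for s s'
  proof (rule DERIV_pos_imp_increasing[OF that(3)])
    fix x assume "s \<le> x" "x \<le> s'"
    then have "x \<in> ?J" using that by auto
    then show "\<exists>y. (\<tau> has_real_derivative y) (at x) \<and> y > 0"
      using d\<tau>[of x] f(2)[of x] by (intro exI[of _ "1 / f x"]) simp
  qed
  then have inj: "inj_on \<tau> ?J"
    by (intro linorder_inj_onI) (auto simp: less_imp_neq)
  have cont: "continuous_on ?J \<tau>"
    using DERIV_isCont[OF d\<tau>] by (intro continuous_at_imp_continuous_on ballI)
  define I where "I = \<tau> ` ?J"
  define \<sigma> where "\<sigma> = inv_into ?J \<tau>"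
  have "open I" unfolding I_def by (rule invariance_of_domain[OF cont _ inj]) simp
  have "is_interval I"
    unfolding I_def is_interval_connected_1 by (rule connected_continuous_image[OF cont]) simp
  have \<sigma>\<tau>: "\<sigma> (\<tau> s) = s" if "s \<in> ?J" for s
    unfolding \<sigma>_def by (rule inv_into_f_f[OF inj that])
  then have im: "\<sigma> ` I = ?J" unfolding I_def image_image by simp
  have d\<sigma>: "(\<sigma> has_derivative (*) (f (\<sigma> t))) (at t)" if "t \<in> I" for t
  proof -
    obtain s where s: "s \<in> ?J" "t = \<tau> s" using \<open>t \<in> I\<close> by (auto simp: I_def)
    have "(\<sigma> has_derivative (*) (f s)) (at (\<tau> s))"
    proof (rule has_derivative_inverse_strong[OF _ s(1) cont \<sigma>\<tau>])
      show "(\<tau> has_derivative (*) (1 / f s)) (at s)"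
        using d\<tau>[OF s(1)] by (simp add: has_field_derivative_def)
      show "(*) (1 / f s) \<circ> (*) (f s) = id"
        using f(2)[OF s(1)] by (auto simp: fun_eq_iff)
    qed auto
    then show ?thesis using s \<sigma>\<tau> by simp
  qed
  have "smooth_on I \<sigma>"
  proof (rule smooth_on_bootstrap[OF \<open>open I\<close> d\<sigma>])
    fix k v assume k: "Ck_on k I \<sigma>"
    have "Ck_on k I (\<lambda>t. f (\<sigma> t))"
      using im f(1) by (intro Ck_on_compose[OF \<open>open I\<close> _ _ _ k, of ?J]) (auto simp: smooth_on_def)
    then show "Ck_on k I (\<lambda>t. f (\<sigma> t) * v)"
      by (rule Ck_on_bounded_linear[OF bounded_linear_mult_left \<open>open I\<close>])
  qed
  with \<open>open I\<close> \<open>is_interval I\<close> im show thesis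
    by (rule that) (use d\<sigma> in \<open>simp add: has_field_derivative_def\<close>)
qed

context
  fixes M :: "'m topology" and A :: "('m, 'n::finite) chart set"
  assumes M: "smooth_manifold M A"
begin

text \<open>\<open>geodesic\<close> demands the equation in every chart, whereas it is solved in an
  affine one. The second derivative in the acceleration cancels the one in the transformation law of
  the connection.\<close>

lemma geodesic_equation_change:
  assumes N: "affine_connection A N" and I: "open I" and \<gamma>: "smooth_curve M A I \<gamma>"
    and c: "c \<in> A" "c' \<in> A" and t: "t \<in> I" "\<gamma> t \<in> chart_dom c" "\<gamma> t \<in> chart_dom c'"
    and geo: "vector_derivative (velocity c \<gamma>) (at t) + N c (\<gamma> t) (velocity c \<gamma> t) (velocity c \<gamma> t) = 0"
  shows "vector_derivative (velocity c' \<gamma>) (at t) + N c' (\<gamma> t) (velocity c' \<gamma> t) (velocity c' \<gamma> t) = 0"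
proof -
  let ?S = "coord c ` (chart_dom c \<inter> chart_dom c')" and ?T = "transition c c'"
  let ?J = "{s \<in> I. \<gamma> s \<in> chart_dom c} \<inter> {s \<in> I. \<gamma> s \<in> chart_dom c'}"
  let ?v = "velocity c \<gamma> t" and ?w = "vector_derivative (velocity c \<gamma>) (at t)"
  have J: "open ?J" "t \<in> ?J" "(coord c \<circ> \<gamma>) ` ?J \<subseteq> ?S"
    using open_Int[OF open_curve_in_chart[OF M I \<gamma> c(1)] open_curve_in_chart[OF M I \<gamma> c(2)]] t by auto
  from acceleration_chain_rule[OF open_overlap[OF M c] transition_smooth[OF M c] J
      velocity_has_vector_derivative(1)[OF M I \<gamma> c(1) t(1,2)] velocity_derivative[OF M I \<gamma> c(1) t(1,2)]]
  have "((\<lambda>s. change_vec c c' (\<gamma> s) (velocity c \<gamma> s)) has_vector_derivative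
      second_derivative ?T (coord c (\<gamma> t)) ?v ?v + change_vec c c' (\<gamma> t) ?w) (at t)"
    by (simp add: change_vec_def)
  then have "(velocity c' \<gamma> has_vector_derivative
      second_derivative ?T (coord c (\<gamma> t)) ?v ?v + change_vec c c' (\<gamma> t) ?w) (at t)"
    by (rule has_vector_derivative_transform_within_open[OF _ J(1,2)])
      (use velocity_change[OF M I \<gamma> c] in auto)
  then have a: "vector_derivative (velocity c' \<gamma>) (at t) =
      second_derivative ?T (coord c (\<gamma> t)) ?v ?v + change_vec c c' (\<gamma> t) ?w"
    by (rule vector_derivative_at)
  have "?w = - N c (\<gamma> t) ?v ?v" using geo by (simp add: eq_neg_iff_add_eq_0)
  then have "change_vec c c' (\<gamma> t) ?w = - change_vec c c' (\<gamma> t) (N c (\<gamma> t) ?v ?v)"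
    by (simp add: linear_neg[OF linear_change_vec[OF M c t(2,3)]])
  moreover have "change_vec c c' (\<gamma> t) (N c (\<gamma> t) ?v ?v) = second_derivative ?T (coord c (\<gamma> t)) ?v ?v +
      N c' (\<gamma> t) (change_vec c c' (\<gamma> t) ?v) (change_vec c c' (\<gamma> t) ?v)"
    using N c t unfolding affine_connection_def by blast
  ultimately show ?thesis
    unfolding a velocity_change[OF M I \<gamma> c t] by simp
qed

text \<open>An affine chart covers the curve only locally, so the vanishing derivative is
  established for one chart-independent speed function on the whole interval.\<close>

lemma isochrone_hybrid:
  assumes E: "pseudo_Euclidean_manifold M A D g"
    and \<psi>: "smooth_function A (topspace M) \<psi>" "\<And>p. p \<in> topspace M \<Longrightarrow> \<psi> p \<noteq> 0" and a: "a \<noteq> 0"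
  shows "isochrone M A (hybrid_connection D \<psi>) (scale_tensor (\<lambda>p. a / \<psi> p ^ 4) g)"
proof -
  have D: "flat_connection A D" "affine_connection A D" and g: "pseudo_metric A g"
    using E by (auto simp: pseudo_Euclidean_manifold_def Hessian_manifold_def flat_connection_def)
  define h where "h = scale_tensor (\<lambda>p. a / \<psi> p ^ 4) g"
  have h: "pseudo_metric A h"
    unfolding h_def
    by (rule pseudo_metric_scale[OF M g smooth_function_inverse_power[OF M \<psi>]]) (use \<psi>(2) a in auto)
  have "\<exists>s. \<forall>t\<in>I. \<forall>c\<in>A. \<gamma> t \<in> chart_dom c \<longrightarrow> h c (\<gamma> t) (velocity c \<gamma> t) (velocity c \<gamma> t) = s"
    if "geodesic M A (hybrid_connection D \<psi>) I \<gamma>" for I \<gamma>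
  proof -
    have I: "open I" "is_interval I" "smooth_curve M A I \<gamma>"
      and geo: "\<And>c t. c \<in> A \<Longrightarrow> t \<in> I \<Longrightarrow> \<gamma> t \<in> chart_dom c \<Longrightarrow>
        vector_derivative (velocity c \<gamma>) (at t) +
        hybrid_connection D \<psi> c (\<gamma> t) (velocity c \<gamma> t) (velocity c \<gamma> t) = 0"
      using that by (auto simp: geodesic_def)
    have \<gamma>M: "\<gamma> t \<in> topspace M" if "t \<in> I" for t
      using I(3) that continuous_map_image_subset_topspace unfolding smooth_curve_def by fastforce
    \<comment> \<open>A chart is picked at each time to make the speed a function of
      \<open>t\<close> alone; the choice does not affect its value because \<open>h\<close> is a
      tensor.\<close>
    define C where "C t = (SOME c. c \<in> A \<and> \<gamma> t \<in> chart_dom c)" for t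
    define s where "s t = h (C t) (\<gamma> t) (velocity (C t) \<gamma> t) (velocity (C t) \<gamma> t)" for t
    have s: "h c (\<gamma> t) (velocity c \<gamma> t) (velocity c \<gamma> t) = s t"
      if "c \<in> A" "t \<in> I" "\<gamma> t \<in> chart_dom c" for c t
    proof -
      have C: "C t \<in> A" "\<gamma> t \<in> chart_dom (C t)"
        using someI[of "\<lambda>c. c \<in> A \<and> \<gamma> t \<in> chart_dom c" c] that unfolding C_def by auto
      show ?thesis
        unfolding s_def pseudo_metricD(4)[OF h that(1,3) C] velocity_change[OF M I(1,3) that(1) C(1) that(2,3) C(2)] ..
    qed
    have "(s has_real_derivative 0) (at t)" if t: "t \<in> I" for t
    proof -
      obtain c where c: "c \<in> affine_charts A D" "\<gamma> t \<in> chart_dom c" "connectedin M (chart_dom c)"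
        using affine_chart_exists[OF M D(1) \<gamma>M[OF t]] by blast
      then have cA: "c \<in> A" by (simp add: affine_charts_def)
      \<comment> \<open>Connectedness of the domain makes \<open>g c\<close> one and the same form
        on the whole chart, so that it can serve as the fixed form \<open>b\<close> in
        \<open>speed_derivative_zero\<close>.\<close>
      have gc: "g c p = g c (\<gamma> t)" if "p \<in> chart_dom c" for p
        using E c that unfolding pseudo_Euclidean_manifold_def by blast
      have "((\<lambda>t'. a / \<psi> (\<gamma> t') ^ 4 * g c (\<gamma> t) (velocity c \<gamma> t') (velocity c \<gamma> t')) has_real_derivative 0) (at t)"
        by (rule speed_derivative_zero[OF M I(1,3) \<psi> c(1) t c(2) pseudo_metricD(1)[OF g cA c(2)] geo[OF cA t c(2)]])
      then show ?thesis
      proof (rule has_field_derivative_transform_within_open)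
        show "open {t \<in> I. \<gamma> t \<in> chart_dom c}" by (rule open_curve_in_chart[OF M I(1,3) cA])
        fix t' assume "t' \<in> {t \<in> I. \<gamma> t \<in> chart_dom c}"
        then show "a / \<psi> (\<gamma> t') ^ 4 * g c (\<gamma> t) (velocity c \<gamma> t') (velocity c \<gamma> t') = s t'"
          using s[OF cA, of t'] gc[of "\<gamma> t'"] by (simp add: h_def scale_tensor_def)
      qed (use t c in auto)
    qed
    then have "(s has_derivative (\<lambda>_. 0)) (at t within I)" if "t \<in> I" for t
      using that by (simp add: has_field_derivative_def has_derivative_at_withinI lambda_zero)
    then have "\<exists>k. \<forall>t\<in>I. s t = k"
      using has_derivative_zero_constant[of I s] I(2) is_interval_convex by blast
    then show ?thesis using s by metis
  qed
  with h affine_connection_hybrid[OF M D(2) \<psi>] show ?thesis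
    unfolding isochrone_def h_def by blast
qed

end

subsection \<open>Conformal factors\<close>

lemma smooth_on_line:
  fixes x v :: "'a::real_normed_vector"
  shows "open J \<Longrightarrow> smooth_on J (\<lambda>s::real. x + s *\<^sub>R v)"
  by (intro smooth_on_add smooth_on_const smooth_on_bounded_linear[OF bounded_linear_scaleR_left] smooth_on_ident)

lemma bilinear_line_speed:
  "bilinear b \<Longrightarrow> b (c *\<^sub>R v) (c *\<^sub>R v) = c\<^sup>2 * (b v v :: real)"
  by (simp add: bilinear_lmul bilinear_rmul power2_eq_square)

text \<open>By polarization, a symmetric form that vanishes on the diagonal is zero, contrary to
  nondegeneracy.\<close>

lemma nonnull_vector_exists:
  fixes b :: "real ^ 'n \<Rightarrow> real ^ 'n \<Rightarrow> real"
  assumes b: "bilinear b" "\<And>u v. b u v = b v u" "\<And>u. (\<And>v. b u v = 0) \<Longrightarrow> u = 0"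
  obtains e where "b e e \<noteq> 0"
proof -
  have "\<exists>e. b e e \<noteq> 0"
  proof (rule ccontr)
    assume "\<not> ?thesis"
    then have z: "b e e = 0" for e by simp
    have "b u v = 0" for u v
      using z[of "u + v"] z[of u] z[of v] b(2)[of u v]
      by (simp add: bilinear_ladd[OF b(1)] bilinear_radd[OF b(1)])
    \<comment> \<open>Any nonzero vector gives the contradiction; \<open>undefined\<close> merely
      names an index, as index types are nonempty.\<close>
    then have "axis undefined 1 = (0 :: real ^ 'n)" using b(3) by blast
    then show False by (simp add: axis_eq_0_iff)
  qed
  then show thesis using that by blast
qed

context
  fixes M :: "'m topology" and A :: "('m, 'n::finite) chart set"
  assumes M: "smooth_manifold M A"
begin

text \<open>In an affine chart, the hybrid geodesics are the lines \<open>x + \<sigma>(t) v\<close> with \<open>\<sigma>' = \<psi>\<^sup>2\<close> along the line.\<close>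
lemma hybrid_geodesic_through:
  assumes D: "affine_connection A D" and \<psi>: "smooth_function A (topspace M) \<psi>" "\<And>p. p \<in> topspace M \<Longrightarrow> \<psi> p \<noteq> 0"
    and c: "c \<in> affine_charts A D" "convex (coord c ` chart_dom c)"
    and p: "p \<in> chart_dom c" "q \<in> chart_dom c"
  obtains I \<gamma> t0 t1 where "geodesic M A (hybrid_connection D \<psi>) I \<gamma>"
    "t0 \<in> I" "t1 \<in> I" "\<gamma> t0 = p" "\<gamma> t1 = q"
    "\<forall>t\<in>I. \<gamma> t \<in> chart_dom c"
    "\<forall>t\<in>I. velocity c \<gamma> t = (\<psi> (\<gamma> t))\<^sup>2 *\<^sub>R (coord c q - coord c p)"
proof -
  have cA: "c \<in> A" and D0: "\<And>p u v. p \<in> chart_dom c \<Longrightarrow> D c p u v = 0"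
    using c by (auto simp: affine_charts_def)
  note cc [simp] = inv_coord_coord[OF M cA] coord_inv_coord[OF M] inv_coord_in[OF M]
  let ?S = "coord c ` chart_dom c"
  define x where "x = coord c p"
  define v where "v = coord c q - coord c p"
  define K where "K = {s. x + s *\<^sub>R v \<in> ?S}"
  have "open K"
    using open_vimage[OF chartD(2)[OF M cA], of "\<lambda>s. x + s *\<^sub>R v"]
    by (simp add: K_def vimage_def continuous_intros)
  have "0 \<in> K" "1 \<in> K" using p by (auto simp: K_def x_def v_def)
  have Kconv: "s \<in> K" if "s \<in> {0..1}" for s
  proof -
    have "x + s *\<^sub>R v = (1 - s) *\<^sub>R coord c p + s *\<^sub>R coord c q" by (simp add: x_def v_def algebra_simps)
    moreover have "(1 - s) *\<^sub>R coord c p + s *\<^sub>R coord c q \<in> ?S"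
      using c(2) p that by (auto simp: convex_alt)
    ultimately show ?thesis by (simp add: K_def)
  qed
  \<comment> \<open>A geodesic lives on an open interval, so the segment is prolonged a little
    beyond both endpoints within the chart.\<close>
  obtain \<epsilon>0 where e0: "\<epsilon>0 > 0" "ball 0 \<epsilon>0 \<subseteq> K" using \<open>open K\<close> \<open>0 \<in> K\<close> open_contains_ball by blast
  obtain \<epsilon>1 where e1: "\<epsilon>1 > 0" "ball 1 \<epsilon>1 \<subseteq> K" using \<open>open K\<close> \<open>1 \<in> K\<close> open_contains_ball by blast
  define J where "J = {- \<epsilon>0<..<1 + \<epsilon>1}"
  have J: "open J" "0 \<in> J" "1 \<in> J" using e0 e1 by (auto simp: J_def)
  have JK: "x + s *\<^sub>R v \<in> ?S" if "s \<in> J" for s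
  proof -
    have "s \<in> ball 0 \<epsilon>0 \<or> s \<in> {0..1} \<or> s \<in> ball 1 \<epsilon>1" using that e0 e1 by (auto simp: J_def dist_real_def)
    then have "s \<in> K" using e0 e1 Kconv by blast
    then show ?thesis by (simp add: K_def)
  qed
  \<comment> \<open>Along the line the derivative of \<open>\<psi>\<^sup>2 v\<close> is
    \<open>2 \<psi> d v\<close>, which is \<open>2 d / \<psi>\<close> times the velocity; this is
    the hybrid geodesic equation.\<close>
  define f where "f s = ((\<psi> \<circ> inv_coord c) (x + s *\<^sub>R v))\<^sup>2" for s
  have "smooth_on J f"
    unfolding f_def[abs_def]
    by (intro smooth_on_power smooth_on_compose[OF J(1) chartD(2)[OF M cA] _ smooth_function_chart[OF M \<psi>(1) cA]]
        smooth_on_line J) (use JK in auto)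
  note smJ = this[unfolded J_def]
  have pos: "f s > 0" if "s \<in> {- \<epsilon>0<..<1 + \<epsilon>1}" for s
    using that[folded J_def] \<psi>(2) inv_coord_in[OF M JK[of s]] chartD(3)[OF M cA] by (auto simp: f_def)
  have "- \<epsilon>0 < 1 + \<epsilon>1" using e0 e1 by simp
  then obtain I \<sigma> where I: "open I" "is_interval I" and \<sigma>: "\<sigma> ` I = J" "smooth_on I \<sigma>"
    "\<forall>t\<in>I. (\<sigma> has_real_derivative f (\<sigma> t)) (at t)"
    unfolding J_def by (rule autonomous_ode_solution[OF _ smJ pos])
  define \<gamma> where "\<gamma> t = inv_coord c (x + \<sigma> t *\<^sub>R v)" for t
  have \<sigma>S: "x + \<sigma> t *\<^sub>R v \<in> ?S" if "t \<in> I" for t using JK \<sigma>(1) that by blast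
  have \<gamma>c: "\<gamma> t \<in> chart_dom c" "coord c (\<gamma> t) = x + \<sigma> t *\<^sub>R v" if "t \<in> I" for t
    using \<sigma>S[OF that] by (simp_all add: \<gamma>_def)
  have sml: "smooth_on I (\<lambda>t. x + \<sigma> t *\<^sub>R v)"
    by (intro smooth_on_add smooth_on_const smooth_on_bounded_linear[OF bounded_linear_scaleR_left] I \<sigma>)
  have cont: "continuous_map (top_of_set I) M \<gamma>"
  proof -
    have a: "continuous_map (top_of_set ?S) M (inv_coord c)"
      using homeomorphic_maps_chart[OF M cA] continuous_map_in_subtopology
      unfolding homeomorphic_maps_def by blast
    have b: "continuous_map (top_of_set I) (top_of_set ?S) (\<lambda>t. x + \<sigma> t *\<^sub>R v)"
      using smooth_on_imp_continuous_on[OF sml] \<sigma>S by auto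
    show ?thesis
      using continuous_map_compose[OF b a] by (simp add: \<gamma>_def[abs_def] o_def)
  qed
  have curve: "smooth_curve M A I \<gamma>"
    unfolding smooth_curve_def
  proof (intro conjI ballI cont)
    fix c' assume c': "c' \<in> A"
    let ?O = "{t \<in> I. \<gamma> t \<in> chart_dom c'}"
    have O: "open ?O" by (rule open_in_chart_vimage[OF M I(1) cont c'])
    \<comment> \<open>In an arbitrary chart the curve is the line followed by a transition
      map.\<close>
    have "smooth_on ?O (\<lambda>t. transition c c' (x + \<sigma> t *\<^sub>R v))"
    proof (rule smooth_on_compose[OF O open_overlap[OF M cA c'] _ transition_smooth[OF M cA c']])
      show "(\<lambda>t. x + \<sigma> t *\<^sub>R v) ` ?O \<subseteq> coord c ` (chart_dom c \<inter> chart_dom c')"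
        using \<gamma>c by (auto simp: image_iff) (metis IntI)
      show "smooth_on ?O (\<lambda>t. x + \<sigma> t *\<^sub>R v)" by (rule smooth_on_subset[OF sml]) auto
    qed
    then show "smooth_on ?O (coord c' \<circ> \<gamma>)" by (simp add: transition_def \<gamma>_def[abs_def] o_def)
  qed
  have fQ: "f (\<sigma> t) = (\<psi> (\<gamma> t))\<^sup>2" for t by (simp add: f_def \<gamma>_def)
  have vel: "velocity c \<gamma> t = (\<psi> (\<gamma> t))\<^sup>2 *\<^sub>R v" if t: "t \<in> I" for t
  proof -
    have "((\<lambda>t. \<sigma> t *\<^sub>R v) has_vector_derivative (\<psi> (\<gamma> t))\<^sup>2 *\<^sub>R v) (at t)"
      using \<sigma>(3)[rule_format, OF t] unfolding fQ has_real_derivative_iff_has_vector_derivative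
      by (rule bounded_linear.has_vector_derivative[OF bounded_linear_scaleR_left])
    from has_vector_derivative_add[OF has_vector_derivative_const[of x] this]
    have "((\<lambda>t. x + \<sigma> t *\<^sub>R v) has_vector_derivative (\<psi> (\<gamma> t))\<^sup>2 *\<^sub>R v) (at t)" by simp
    then have "((coord c \<circ> \<gamma>) has_vector_derivative (\<psi> (\<gamma> t))\<^sup>2 *\<^sub>R v) (at t)"
      by (rule has_vector_derivative_transform_within_open[OF _ I(1) t]) (simp add: \<gamma>c)
    then show ?thesis unfolding velocity_def by (rule vector_derivative_at)
  qed
  have geo_c: "vector_derivative (velocity c \<gamma>) (at t) +
      hybrid_connection D \<psi> c (\<gamma> t) (velocity c \<gamma> t) (velocity c \<gamma> t) = 0" if t: "t \<in> I" for t
  proof -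
    define d where "d = differential c \<psi> (\<gamma> t) (velocity c \<gamma> t)"
    have nz: "\<psi> (\<gamma> t) \<noteq> 0" using \<psi>(2) chartD(3)[OF M cA] \<gamma>c(1)[OF t] by auto
    have "((\<lambda>t. \<psi> (\<gamma> t)) has_real_derivative d) (at t)"
      unfolding d_def by (rule potential_along_curve[OF M I(1) curve \<psi>(1) cA t \<gamma>c(1)[OF t]])
    then have "((\<lambda>t. (\<psi> (\<gamma> t))\<^sup>2) has_real_derivative 2 * \<psi> (\<gamma> t) * d) (at t)"
      by (auto intro!: derivative_eq_intros)
    then have "((\<lambda>t. (\<psi> (\<gamma> t))\<^sup>2 *\<^sub>R v) has_vector_derivative (2 * \<psi> (\<gamma> t) * d) *\<^sub>R v) (at t)"
      unfolding has_real_derivative_iff_has_vector_derivative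
      by (rule bounded_linear.has_vector_derivative[OF bounded_linear_scaleR_left])
    then have "(velocity c \<gamma> has_vector_derivative (2 * \<psi> (\<gamma> t) * d) *\<^sub>R v) (at t)"
      by (rule has_vector_derivative_transform_within_open[OF _ I(1) t]) (simp add: vel)
    then have "vector_derivative (velocity c \<gamma>) (at t) = (2 * \<psi> (\<gamma> t) * d) *\<^sub>R v"
      by (rule vector_derivative_at)
    then show ?thesis
      unfolding hybrid_connection_def d_def[symmetric] D0[OF \<gamma>c(1)[OF t]]
      using nz by (simp add: vel[OF t] scaleR_left_distrib[symmetric] power2_eq_square)
  qed
  have geo: "geodesic M A (hybrid_connection D \<psi>) I \<gamma>"
    unfolding geodesic_def
    using geodesic_equation_change[OF M affine_connection_hybrid[OF M D \<psi>] I(1) curve cA _ _ \<gamma>c(1) _ geo_c]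
    by (auto intro: I curve)
  \<comment> \<open>\<open>\<sigma>\<close> runs through all of \<open>J\<close>, so the line
    parameters 0 and 1 of the two endpoints are attained.\<close>
  obtain t0 t1 where t: "t0 \<in> I" "\<sigma> t0 = 0" "t1 \<in> I" "\<sigma> t1 = 1"
    using J(2,3) unfolding \<sigma>(1)[symmetric] by force
  have ends: "\<gamma> t0 = p" "\<gamma> t1 = q"
    using p t by (simp_all add: \<gamma>_def x_def v_def)
  show thesis
    by (rule that[OF geo t(1,3) ends]) (use \<gamma>c(1) vel in \<open>simp_all add: v_def\<close>)
qed

text \<open>Both endpoints lie on one geodesic whose velocities are multiples of the same vector;
  the common value of \<open>b\<close> on that vector is nonzero and cancels.\<close>

lemma conformal_factor_along_line:
  assumes D: "affine_connection A D" and \<psi>: "smooth_function A (topspace M) \<psi>" "\<And>p. p \<in> topspace M \<Longrightarrow> \<psi> p \<noteq> 0"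
    and c: "c \<in> affine_charts A D" "convex (coord c ` chart_dom c)"
    and g: "\<And>p. p \<in> chart_dom c \<Longrightarrow> g c p = b" and b: "bilinear b"
    and iso: "isochrone M A (hybrid_connection D \<psi>) (scale_tensor \<rho> g)"
    and p: "p \<in> chart_dom c" "q \<in> chart_dom c"
    and nonnull: "b (coord c q - coord c p) (coord c q - coord c p) \<noteq> 0"
  shows "\<rho> p * \<psi> p ^ 4 = \<rho> q * \<psi> q ^ 4"
proof -
  have cA: "c \<in> A" using c by (simp add: affine_charts_def)
  obtain I \<gamma> t0 t1 where geo: "geodesic M A (hybrid_connection D \<psi>) I \<gamma>"
    and t: "t0 \<in> I" "t1 \<in> I" "\<gamma> t0 = p" "\<gamma> t1 = q"
    and dom: "\<forall>t\<in>I. \<gamma> t \<in> chart_dom c"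
    and vel: "\<forall>t\<in>I. velocity c \<gamma> t = (\<psi> (\<gamma> t))\<^sup>2 *\<^sub>R (coord c q - coord c p)"
    by (rule hybrid_geodesic_through[OF D \<psi> c p])
  have "\<exists>s. \<forall>t\<in>I. \<forall>c\<in>A. \<gamma> t \<in> chart_dom c \<longrightarrow>
      scale_tensor \<rho> g c (\<gamma> t) (velocity c \<gamma> t) (velocity c \<gamma> t) = s"
    using iso geo by (simp add: isochrone_def)
  then obtain s where "\<forall>t\<in>I. \<forall>c\<in>A. \<gamma> t \<in> chart_dom c \<longrightarrow>
      scale_tensor \<rho> g c (\<gamma> t) (velocity c \<gamma> t) (velocity c \<gamma> t) = s" by (rule exE)
  then have s: "scale_tensor \<rho> g c (\<gamma> t) (velocity c \<gamma> t) (velocity c \<gamma> t) = s" if "t \<in> I" for t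
    using that cA dom by (simp only:)
  have "\<rho> (\<gamma> t) * (\<psi> (\<gamma> t) ^ 4 * b (coord c q - coord c p) (coord c q - coord c p)) = s" if "t \<in> I" for t
    using s[OF that] by (simp add: scale_tensor_def g[OF dom[rule_format, OF that]] vel[rule_format, OF that] bilinear_line_speed[OF b])
  from this[OF t(1)] this[OF t(2)]
  have "(\<rho> p * \<psi> p ^ 4) * b (coord c q - coord c p) (coord c q - coord c p) =
      (\<rho> q * \<psi> q ^ 4) * b (coord c q - coord c p) (coord c q - coord c p)"
    by (simp only: t(3,4) mult.assoc)
  then show ?thesis by (rule iffD1[OF mult_right_cancel[OF nonnull]])
qed

text \<open>A null direction \<open>v\<close> is bypassed through a third point \<open>r\<close>,
  reached from \<open>p\<close> by a short non-null vector \<open>t *\<^sub>R e\<close>. The step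
  from \<open>p\<close> to \<open>r\<close> is non-null for every \<open>t \<noteq> 0\<close>, and
  the step from \<open>r\<close> to \<open>q\<close> fails for at most one such
  \<open>t\<close>.\<close>

lemma conformal_factor_locally_constant:
  assumes D: "affine_connection A D" and \<psi>: "smooth_function A (topspace M) \<psi>" "\<And>p. p \<in> topspace M \<Longrightarrow> \<psi> p \<noteq> 0"
    and c: "c \<in> affine_charts A D" "convex (coord c ` chart_dom c)"
    and g: "\<And>p. p \<in> chart_dom c \<Longrightarrow> g c p = b"
    and b: "bilinear b" "\<And>u v. b u v = b v u" "\<And>u. (\<And>v. b u v = 0) \<Longrightarrow> u = 0"
    and iso: "isochrone M A (hybrid_connection D \<psi>) (scale_tensor \<rho> g)"
    and p: "p \<in> chart_dom c" "q \<in> chart_dom c"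
  shows "\<rho> p * \<psi> p ^ 4 = \<rho> q * \<psi> q ^ 4"
proof -
  have cA: "c \<in> A" using c by (simp add: affine_charts_def)
  have line: "\<rho> r * \<psi> r ^ 4 = \<rho> r' * \<psi> r' ^ 4"
    if "r \<in> chart_dom c" "r' \<in> chart_dom c" "b (coord c r' - coord c r) (coord c r' - coord c r) \<noteq> 0" for r r'
    by (rule conformal_factor_along_line[OF D \<psi> c g b(1) iso that])
  define x where "x = coord c p"
  define v where "v = coord c q - x"
  show ?thesis
  proof (cases "b v v = 0")
    case False
    then show ?thesis using line[OF p] by (simp add: v_def x_def)
  next
    case True
    obtain e where e: "b e e \<noteq> 0" using nonnull_vector_exists[OF b] by blast
    have "open {s. x + s *\<^sub>R e \<in> coord c ` chart_dom c}"
      using open_vimage[OF chartD(2)[OF M cA], of "\<lambda>s. x + s *\<^sub>R e"] by (simp add: vimage_def continuous_intros)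
    moreover have "0 \<in> {s. x + s *\<^sub>R e \<in> coord c ` chart_dom c}" using p by (simp add: x_def)
    ultimately obtain \<epsilon> where \<epsilon>0: "\<epsilon> > 0" "ball 0 \<epsilon> \<subseteq> {s. x + s *\<^sub>R e \<in> coord c ` chart_dom c}"
      using open_contains_ball by metis
    have \<epsilon>: "x + s *\<^sub>R e \<in> coord c ` chart_dom c" if "\<bar>s\<bar> < \<epsilon>" for s
      using subsetD[OF \<epsilon>0(2), of s] that by (simp add: dist_real_def)
    \<comment> \<open>The value to avoid solves \<open>t * b e e = 2 * b v e\<close>. It is unique
      because \<open>b e e \<noteq> 0\<close>, so one of \<open>\<epsilon> / 2\<close> and
      \<open>\<epsilon> / 3\<close> is admissible.\<close>
    obtain t where t: "t \<noteq> 0" "\<bar>t\<bar> < \<epsilon>" "t * b e e \<noteq> 2 * b v e"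
    proof (cases "\<epsilon> / 2 * b e e = 2 * b v e")
      case True
      moreover from this have "b v e \<noteq> 0" using \<epsilon>0(1) e by auto
      ultimately show thesis using that[of "\<epsilon> / 3"] \<epsilon>0(1) e by auto
    qed (use that[of "\<epsilon> / 2"] \<epsilon>0(1) in auto)
    obtain r where r: "r \<in> chart_dom c" "coord c r = x + t *\<^sub>R e" using \<epsilon>[OF t(2)] by auto
    have "b (coord c r - x) (coord c r - x) \<noteq> 0"
      using e t by (simp add: r bilinear_line_speed[OF b(1)])
    then have "\<rho> p * \<psi> p ^ 4 = \<rho> r * \<psi> r ^ 4" using line[OF p(1) r(1)] by (simp add: x_def)
    moreover have "b (coord c q - coord c r) (coord c q - coord c r) \<noteq> 0"
    proof -
      have eq: "coord c q - coord c r = v - t *\<^sub>R e" by (simp add: r v_def)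
      \<comment> \<open>Since \<open>b v v = 0\<close>, this quadratic polynomial in
        \<open>t\<close> has no constant term and factors.\<close>
      have "b (v - t *\<^sub>R e) (v - t *\<^sub>R e) = t * (t * b e e - 2 * b v e)"
        using True b(2)[of e v]
        by (simp add: bilinear_lsub[OF b(1)] bilinear_rsub[OF b(1)] bilinear_lmul[OF b(1)] bilinear_rmul[OF b(1)] algebra_simps)
      then show ?thesis unfolding eq using t by simp
    qed
    then have "\<rho> r * \<psi> r ^ 4 = \<rho> q * \<psi> q ^ 4" by (rule line[OF r(1) p(2)])
    ultimately show ?thesis by simp
  qed
qed

end

section \<open>From local to global\<close>

text \<open>The values of \<open>f\<close> carry no topology: preimages of arbitrary sets are open,
  so each level set is open and closed.\<close>

lemma connected_space_locally_constant:
  assumes X: "connected_space X"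
    and loc: "\<And>p. p \<in> topspace X \<Longrightarrow> \<exists>V. openin X V \<and> p \<in> V \<and> (\<forall>q\<in>V. f q = f p)"
    and p: "p \<in> topspace X" "q \<in> topspace X"
  shows "f p = f q"
proof -
  have op: "openin X {r \<in> topspace X. f r \<in> Y}" for Y
  proof (subst openin_subopen, intro ballI)
    fix r assume r: "r \<in> {r \<in> topspace X. f r \<in> Y}"
    then obtain V where "openin X V" "r \<in> V" "\<forall>q\<in>V. f q = f r" using loc by blast
    then show "\<exists>T. openin X T \<and> r \<in> T \<and> T \<subseteq> {r \<in> topspace X. f r \<in> Y}"
      using r openin_subset by (intro exI[of _ V]) fastforce
  qed
  have "topspace X - {r \<in> topspace X. f r \<in> {f p}} = {r \<in> topspace X. f r \<in> - {f p}}" by auto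
  then have "closedin X {r \<in> topspace X. f r \<in> {f p}}"
    using op[of "- {f p}"] by (auto simp: closedin_def)
  with X op[of "{f p}"] have "{r \<in> topspace X. f r \<in> {f p}} = {} \<or> {r \<in> topspace X. f r \<in> {f p}} = topspace X"
    unfolding connected_space_clopen_in by blast
  then have "q \<in> {r \<in> topspace X. f r \<in> {f p}}" using p by blast
  then show ?thesis by simp
qed

theorem proposition6p3:
  fixes M :: "'m topology"
    and A :: "('m, 'n::finite) chart set"
    and D :: "('m, 'n) connection"
    and g :: "('m, 'n) tensor02"
    and \<psi> :: "'m \<Rightarrow> real"
  assumes "pseudo_Euclidean_manifold M A D g"
    and "hybrid_potential M A D g \<psi>"
  shows "(\<forall>\<alpha>::real. \<alpha> > 0 \<longrightarrow>
            isochrone M A (hybrid_connection D \<psi>) (scale_tensor (\<lambda>p. \<alpha>\<^sup>2 / \<psi> p ^ 4) g)) \<and>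
         (\<forall>\<rho>::'m \<Rightarrow> real.
            (\<forall>p\<in>topspace M. \<rho> p > 0) \<and>
            isochrone M A (hybrid_connection D \<psi>) (scale_tensor \<rho> g) \<longrightarrow>
            (\<exists>\<alpha>>0. \<forall>p\<in>topspace M. \<rho> p = \<alpha>\<^sup>2 / \<psi> p ^ 4))"
proof -
  have M: "smooth_manifold M A" "connected_space M" and D: "flat_connection A D" "affine_connection A D"
    and g: "pseudo_metric A g"
    using assms(1) by (auto simp: pseudo_Euclidean_manifold_def Hessian_manifold_def flat_connection_def)
  have \<psi>: "smooth_function A (topspace M) \<psi>" "\<And>p. p \<in> topspace M \<Longrightarrow> \<psi> p \<noteq> 0"
    using assms(2) by (auto simp: hybrid_potential_def)
  show ?thesis
  proof (intro conjI allI impI)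
    fix \<alpha> :: real assume "\<alpha> > 0"
    then show "isochrone M A (hybrid_connection D \<psi>) (scale_tensor (\<lambda>p. \<alpha>\<^sup>2 / \<psi> p ^ 4) g)"
      by (intro isochrone_hybrid[OF M(1) assms(1) \<psi>]) auto
  next
    fix \<rho> :: "'m \<Rightarrow> real"
    assume "(\<forall>p\<in>topspace M. \<rho> p > 0) \<and> isochrone M A (hybrid_connection D \<psi>) (scale_tensor \<rho> g)"
    then have \<rho>: "\<And>p. p \<in> topspace M \<Longrightarrow> \<rho> p > 0"
      and iso: "isochrone M A (hybrid_connection D \<psi>) (scale_tensor \<rho> g)" by auto
    \<comment> \<open>\<open>F\<close> is the quantity to be identified with
      \<open>\<alpha>\<^sup>2\<close>.\<close>
    define F where "F p = \<rho> p * \<psi> p ^ 4" for p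
    have "\<exists>V. openin M V \<and> p \<in> V \<and> (\<forall>q\<in>V. F q = F p)" if p: "p \<in> topspace M" for p
    proof -
      obtain c where c: "c \<in> affine_charts A D" "p \<in> chart_dom c" "convex (coord c ` chart_dom c)" "connectedin M (chart_dom c)"
        using affine_chart_exists[OF M(1) D(1) p] by blast
      then have cA: "c \<in> A" by (simp add: affine_charts_def)
      have gc: "g c q = g c p" if "q \<in> chart_dom c" for q
        using assms(1) c that unfolding pseudo_Euclidean_manifold_def by blast
      have "F q = F p" if "q \<in> chart_dom c" for q
        unfolding F_def
        by (rule conformal_factor_locally_constant[OF M(1) D(2) \<psi> c(1,3) gc pseudo_metricD(1-3)[OF g cA c(2)] iso that c(2)])
      then show ?thesis using c(2) chartD(1)[OF M(1) cA] by blast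
    qed
    then have const: "F p = F q" if "p \<in> topspace M" "q \<in> topspace M" for p q
      using connected_space_locally_constant[OF M(2) _ that, of F] by simp
    show "\<exists>\<alpha>>0. \<forall>p\<in>topspace M. \<rho> p = \<alpha>\<^sup>2 / \<psi> p ^ 4"
    proof (cases "topspace M = {}")
      \<comment> \<open>\<open>connected_space\<close> admits the empty space, where any positive
        constant serves.\<close>
      case True
      then show ?thesis by (intro exI[of _ 1]) simp
    next
      case False
      then obtain p0 where p0: "p0 \<in> topspace M" by blast
      \<comment> \<open>The sign of \<open>\<psi>\<close> is unknown, but the exponent is even; this
        makes the constant positive, so that it has a positive square root \<alpha>.\<close>
      have "\<psi> p0 ^ 4 > 0" using \<psi>(2)[OF p0] by (simp add: zero_less_power_eq)
      then have F0: "F p0 > 0" using \<rho>[OF p0] by (simp add: F_def)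
      show ?thesis
      proof (intro exI conjI ballI)
        show "sqrt (F p0) > 0" using F0 by simp
        fix p assume p: "p \<in> topspace M"
        have "\<rho> p * \<psi> p ^ 4 = F p0" using const[OF p p0] by (simp add: F_def)
        then show "\<rho> p = (sqrt (F p0))\<^sup>2 / \<psi> p ^ 4" using \<psi>(2)[OF p] F0 by (simp add: field_simps)
      qed
    qed
  qed
qed

end
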